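(* For $\alpha\in\mathbb{R}$ and $1\le s\le M$ let $C_{\alpha,s}=\mathrm{diag}(\alpha,\dots,\alpha,0,\dots,0)\in\mathbb{R}^{M\times M}$ with exactly the first $s$ diagonal entries equal to $\alpha$. Then the following hold. (i) There exists a constant $c_4>0$, independent of $\alpha$, $r$, $M$ and $\sigma^2$, such that $$\delta_{C_{\alpha,r},M,\sigma^2,r}\ \le\ c_4\,\sigma^2rM\qquad\text{for all } r\le M-r \text{ and every } \alpha\in\mathbb{R}.$$ (ii) There exists a constant $c_5>0$, independent of $M$, $r$ and $\sigma^2$, such that for all $1\le r<M$ $$\liminf_{|\alpha|\to\infty}\ \max_{s\in\{r,M-r\}}\delta_{C_{\alpha,s},M,\sigma^2,s}\ \ge\ c_5\,\sigma^2r(M-r).$$ Moreover, for $s=r=1$ the same holds without the maximum over $\{1,M-1\}$, i.e. $\liminf_{|\alpha|\to\infty}\delta_{C_{\alpha,1},M,\sigma^2,1}\ge c_5\,\sigma^2(M-1)$.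
   Context: Let $M\in\mathbb{N}$, $\sigma^2>0$ (with $\sigma>0$), and let $\mathrm{E}$ be a random $M\times M$ real matrix whose entries are independent centered Gaussian random variables with variance $\sigma^2$. For $1\le r\le M$, $\mathcal{S}_{M,r}\subset\mathbb{R}^{M\times M}$ is the set of all matrices of orthogonal projections onto $r$-dimensional linear subspaces of $\mathbb{R}^M$. $\|\cdot\|_{S_2}$ is the Hilbert-Schmidt (Frobenius) norm. For a deterministic matrix $C\in\mathbb{R}^{M\times M}$ put $X=C+\mathrm{E}$, let $\hat\pi_r$ be a maximizer of $\tilde\pi_r\mapsto\|\tilde\pi_rX\|_{S_2}^2$ over $\mathcal{S}_{M,r}$, and let $\pi_r$ be a (deterministic) maximizer of $\tilde\pi_r\mapsto\mathbf{E}\|\tilde\pi_rX\|_{S_2}^2$ over $\mathcal{S}_{M,r}$ (equivalently, of $\|\tilde\pi_rC\|_{S_2}^2$). Define $$\delta_{C,M,\sigma^2,r}:=\mathbf{E}\|\hat\pi_rX\|_{S_2}^2-\mathbf{E}\|\pi_rX\|_{S_2}^2=\sum_{i=1}^r\mathbf{E}\big(\hat\lambda_i^2-\lambda_i^2-\sigma^2M\big),$$ where $\hat\lambda_1\ge\dots\ge\hat\lambda_M$ and $\lambda_1\ge\dots\ge\lambda_M$ are the singular values of $X$ and $C$. *)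

theory Defs
  imports "HOL-Probability.Probability" "Jordan_Normal_Form.VS_Connect"
begin

definition hs_norm :: "real mat \<Rightarrow> real" where
  "hs_norm A = sqrt (\<Sum>i<dim_row A. \<Sum>j<dim_col A. (A $$ (i, j))\<^sup>2)"

definition orth_proj_onto :: "nat \<Rightarrow> real Matrix.vec set \<Rightarrow> real mat \<Rightarrow> bool" where
  "orth_proj_onto M V P \<longleftrightarrow>
     P \<in> carrier_mat M M \<and>
     (\<forall>x \<in> carrier_vec M.
        P *\<^sub>v x \<in> V \<and> (\<forall>w \<in> V. scalar_prod (x - P *\<^sub>v x) w = 0))"

definition orth_projs :: "nat \<Rightarrow> nat \<Rightarrow> real mat set" where
  "orth_projs M r =
     {P. \<exists>V. VectorSpace.subspace class_ring V (module_vec TYPE(real) M) \<and>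
             vectorspace.dim class_ring ((module_vec TYPE(real) M)\<lparr>carrier := V\<rparr>) = r \<and>
             orth_proj_onto M V P}"

text \<open>
  The expectations below depend only on the joint law of the noise entries, so the noise is
  realised on the canonical space: a sample point is the family of entries itself. The lemma
  \<open>gaussian_law_iff\<close> characterises this law.
\<close>

definition gaussian_law :: "nat \<Rightarrow> real \<Rightarrow> (nat \<times> nat \<Rightarrow> real) measure" where
  "gaussian_law M \<sigma> =
     (\<Pi>\<^sub>M ij \<in> {..<M} \<times> {..<M}. density lborel (\<lambda>x. ennreal (normal_density 0 \<sigma> x)))"

definition observation :: "real mat \<Rightarrow> nat \<Rightarrow> (nat \<times> nat \<Rightarrow> real) \<Rightarrow> real mat" where
  "observation C M \<omega> = C + Matrix.mat M M \<omega>"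

text \<open>
  \<open>arg_max_on\<close> selects one maximiser (it exists by compactness for \<open>1 \<le> r \<le> M\<close>); the value
  of \<open>delta\<close> does not depend on the selection, as only the maximal values enter.
\<close>

definition empirical_proj :: "nat \<Rightarrow> nat \<Rightarrow> real mat \<Rightarrow> real mat" where
  "empirical_proj M r X = arg_max_on (\<lambda>P. (hs_norm (P * X))\<^sup>2) (orth_projs M r)"

definition population_proj :: "real mat \<Rightarrow> nat \<Rightarrow> real \<Rightarrow> nat \<Rightarrow> real mat" where
  "population_proj C M \<sigma> r =
     arg_max_on (\<lambda>P. \<integral>\<omega>. (hs_norm (P * observation C M \<omega>))\<^sup>2 \<partial>gaussian_law M \<sigma>)
       (orth_projs M r)"

text \<open>The parameter \<open>\<sigma>\<close> is the standard deviation, the variance of the noise being \<open>\<sigma>\<^sup>2\<close>.\<close>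

definition delta :: "real mat \<Rightarrow> nat \<Rightarrow> real \<Rightarrow> nat \<Rightarrow> real" where
  "delta C M \<sigma> r =
     (\<integral>\<omega>. (hs_norm (empirical_proj M r (observation C M \<omega>) * observation C M \<omega>))\<^sup>2
        \<partial>gaussian_law M \<sigma>)
   - (\<integral>\<omega>. (hs_norm (population_proj C M \<sigma> r * observation C M \<omega>))\<^sup>2 \<partial>gaussian_law M \<sigma>)"

definition C_mat :: "nat \<Rightarrow> real \<Rightarrow> nat \<Rightarrow> real mat" where
  "C_mat M \<alpha> s = mat_diag M (\<lambda>i. if i < s then \<alpha> else 0)"

lemma gaussian_law_iff:
  fixes E :: "nat \<times> nat \<Rightarrow> 'w \<Rightarrow> real" and \<Omega> :: "'w measure"
  assumes \<Omega>: "prob_space \<Omega>" and M: "M > 0"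
    and E: "\<And>ij. ij \<in> {..<M} \<times> {..<M} \<Longrightarrow>
              distributed \<Omega> lborel (E ij) (\<lambda>x. ennreal (normal_density 0 \<sigma> x))"
  shows "prob_space.indep_vars \<Omega> (\<lambda>_. borel) E ({..<M} \<times> {..<M}) \<longleftrightarrow>
         distr \<Omega> (\<Pi>\<^sub>M ij \<in> {..<M} \<times> {..<M}. borel) (\<lambda>w. \<lambda>ij\<in>{..<M} \<times> {..<M}. E ij w)
           = gaussian_law M \<sigma>"
proof -
  interpret prob_space \<Omega> by fact
  have rv: "random_variable borel (E ij)" if "ij \<in> {..<M} \<times> {..<M}" for ij
    using distributed_measurable[OF E[OF that]] by simp
  have d: "distr \<Omega> borel (E ij) = density lborel (\<lambda>x. ennreal (normal_density 0 \<sigma> x))"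
    if "ij \<in> {..<M} \<times> {..<M}" for ij
  proof -
    have "distr \<Omega> borel (E ij) = distr \<Omega> lborel (E ij)"
      by (rule distr_cong) auto
    with distributed_distr_eq_density[OF E[OF that]] show ?thesis by simp
  qed
  have ne: "{..<M} \<times> {..<M} \<noteq> {}" using M by auto
  have "(\<Pi>\<^sub>M ij \<in> {..<M} \<times> {..<M}. distr \<Omega> borel (E ij)) = gaussian_law M \<sigma>"
    unfolding gaussian_law_def by (rule PiM_cong) (auto simp: d)
  then show ?thesis
    using indep_vars_iff_distr_eq_PiM'[OF ne, where M' = "\<lambda>_. borel" and X = E] rv
    by simp
qed

end

theory Submission
  imports Defs
begin

text \<open>
  Write \<open>P0\<close> for the projection onto the first \<open>s\<close> coordinates, \<open>Q = 1 - P0\<close>, \<open>E\<close> for the noise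
  and \<open>X = \<alpha> * P0 + E\<close>. For a projection \<open>P\<close> of rank \<open>s\<close>, the expected energy of \<open>P * X\<close> is the
  energy of \<open>\<alpha> * P * P0\<close> plus \<open>\<sigma>\<^sup>2 * s * M\<close>, so \<open>P0\<close> is a population maximiser and \<open>delta\<close> is
  the expectation of the maximal energy minus \<open>\<alpha>\<^sup>2 * s + \<sigma>\<^sup>2 * s * M\<close> (lemma \<open>delta_eq\<close>).

  For the upper bound, replacing \<open>P0\<close> by another projection \<open>P\<close> loses signal energy that is quadratic
  in \<open>\<alpha> * (P0 - P * P0)\<close> and gains a term that is linear in it. Completing the square removes
  \<open>\<alpha>\<close>, and what remains is at most \<open>2 * s\<close> times the squared operator norm of \<open>E\<close>, besides
  \<open>\<alpha>\<^sup>2 * s\<close> and a centred term (lemma \<open>energy_le\<close>). The squared operator norm has expectation of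
  order \<open>\<sigma>\<^sup>2 * M\<close>: unit vectors are replaced by points of a grid of at most \<open>exp (6 * M)\<close> integer
  points, and the maximum of the bilinear form of \<open>E\<close> over the grid is controlled by a sum of
  exponentials, whose expectation is known (lemmas \<open>rounding_to_int_grid\<close>, \<open>card_int_grid\<close>,
  \<open>grid_partition_expectation\<close>).

  For the lower bound, a large \<open>\<alpha>\<close> lets the maximising projection follow the noise: the block
  \<open>G = Q * E * P0\<close> tilts the range of \<open>P0\<close> to the graph of \<open>G / \<alpha>\<close>, and the projection onto
  this graph captures the energy of \<open>G\<close> in addition to that of \<open>P0 * X\<close>, up to an error of order
  \<open>1 / \<alpha>\<close> with integrable coefficients (lemmas \<open>graph_projection\<close>, \<open>perturbed_energy_ge\<close>).
  The expected energy of \<open>G\<close> is \<open>\<sigma>\<^sup>2 * s * (M - s)\<close>, so the lower limit of \<open>delta\<close> is at least this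
  number for each \<open>s\<close>, with constant \<open>1\<close> (lemma \<open>Liminf_delta_ge\<close>).

  The projections of rank \<open>r\<close> are described by polynomial equations for their entries (lemma
  \<open>orth_projs_eq\<close>). This makes them a compact set, on which the maximum of the energy is attained
  and is a measurable function of the noise (lemmas \<open>empirical_proj\<close>,
  \<open>measurable_empirical_energy\<close>).
\<close>

section \<open>The Hilbert-Schmidt inner product\<close>

definition hs_inner :: "real mat \<Rightarrow> real mat \<Rightarrow> real" where
  "hs_inner A B = (\<Sum>i<dim_row A. \<Sum>j<dim_col A. A $$ (i, j) * B $$ (i, j))"

lemma hs_norm_sq: "(hs_norm A)\<^sup>2 = hs_inner A A"
  unfolding hs_norm_def hs_inner_def
  by (simp add: sum_nonneg power2_eq_square)

lemma hs_inner_self_nonneg [simp]: "0 \<le> hs_inner A A"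
  by (metis hs_norm_sq zero_le_power2)

lemma hs_inner_eq_sum:
  "A \<in> carrier_mat n m \<Longrightarrow> hs_inner A B = (\<Sum>p\<in>{..<n} \<times> {..<m}. A $$ p * B $$ p)"
  unfolding hs_inner_def by (auto simp: sum.cartesian_product)

lemma hs_inner_commute:
  assumes "A \<in> carrier_mat n m" "B \<in> carrier_mat n m"
  shows "hs_inner A B = hs_inner B A"
  unfolding hs_inner_eq_sum[OF assms(1)] hs_inner_eq_sum[OF assms(2)] by (simp add: mult.commute)

lemma hs_inner_add_left:
  assumes "A \<in> carrier_mat n m" "B \<in> carrier_mat n m"
  shows "hs_inner (A + B) C = hs_inner A C + hs_inner B C"
proof -
  have AB: "A + B \<in> carrier_mat n m" using assms by simp
  have "hs_inner (A + B) C = (\<Sum>p\<in>{..<n} \<times> {..<m}. A $$ p * C $$ p + B $$ p * C $$ p)"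
    unfolding hs_inner_eq_sum[OF AB] using assms by (intro sum.cong) (auto simp: distrib_right)
  then show ?thesis
    by (simp add: sum.distrib hs_inner_eq_sum[OF assms(1)] hs_inner_eq_sum[OF assms(2)])
qed

lemma hs_inner_smult_left:
  "A \<in> carrier_mat n m \<Longrightarrow> hs_inner (a \<cdot>\<^sub>m A) B = a * hs_inner A B"
  by (subst (1 2) hs_inner_eq_sum[of _ n m]) (auto simp: sum_distrib_left intro!: sum.cong)

lemma hs_inner_diff_left:
  assumes "A \<in> carrier_mat n m" "B \<in> carrier_mat n m"
  shows "hs_inner (A - B) C = hs_inner A C - hs_inner B C"
proof -
  have "A - B = A + (-1) \<cdot>\<^sub>m B" using assms by (intro eq_matI) auto
  then show ?thesis
    using assms hs_inner_add_left[of A n m "(-1) \<cdot>\<^sub>m B" C] hs_inner_smult_left[of B n m "-1" C]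
    by simp
qed

lemma hs_inner_add_right:
  assumes "A \<in> carrier_mat n m" "B \<in> carrier_mat n m" "C \<in> carrier_mat n m"
  shows "hs_inner C (A + B) = hs_inner C A + hs_inner C B"
  using assms hs_inner_add_left[OF assms(1,2), of C]
  by (simp add: hs_inner_commute[OF assms(3)])

lemma hs_inner_diff_right:
  assumes "A \<in> carrier_mat n m" "B \<in> carrier_mat n m" "C \<in> carrier_mat n m"
  shows "hs_inner C (A - B) = hs_inner C A - hs_inner C B"
  using assms hs_inner_diff_left[OF assms(1,2), of C] hs_inner_commute[OF assms(3,1)]
    hs_inner_commute[OF assms(3,2)] hs_inner_commute[OF assms(3) minus_carrier_mat[OF assms(2), of A]]
  by simp

lemma hs_inner_smult_right:
  assumes "A \<in> carrier_mat n m" "C \<in> carrier_mat n m"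
  shows "hs_inner C (a \<cdot>\<^sub>m A) = a * hs_inner C A"
  using assms hs_inner_smult_left[OF assms(1), of a C]
  by (simp add: hs_inner_commute[OF assms(2)])

lemma hs_inner_smult_add_self:
  assumes A: "A \<in> carrier_mat n m" and B: "B \<in> carrier_mat n m"
  shows "hs_inner (a \<cdot>\<^sub>m A + B) (a \<cdot>\<^sub>m A + B)
    = a\<^sup>2 * hs_inner A A + 2 * a * hs_inner A B + hs_inner B B"
proof -
  have aA: "a \<cdot>\<^sub>m A \<in> carrier_mat n m" using A by simp
  show ?thesis
    unfolding hs_inner_add_left[OF aA B] hs_inner_smult_left[OF A] hs_inner_add_right[OF aA B A] hs_inner_add_right[OF aA B B]
      hs_inner_smult_left[OF A] hs_inner_smult_right[OF A A] hs_inner_smult_right[OF A B]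
      hs_inner_commute[OF B A]
    by (simp add: power2_eq_square algebra_simps)
qed

lemma hs_inner_transpose:
  "A \<in> carrier_mat n m \<Longrightarrow> B \<in> carrier_mat n m \<Longrightarrow>
   hs_inner (transpose_mat A) (transpose_mat B) = hs_inner A B"
  unfolding hs_inner_def by (simp add: sum.swap[of _ "{..<m}" "{..<n}"])

lemma mat_mult_index:
  "A \<in> carrier_mat n k \<Longrightarrow> B \<in> carrier_mat k m \<Longrightarrow> i < n \<Longrightarrow> j < m \<Longrightarrow>
   (A * B) $$ (i, j) = (\<Sum>l<k. A $$ (i, l) * B $$ (l, j))"
  by (auto simp: scalar_prod_def lessThan_atLeast0)

text \<open>
  Together with \<open>hs_inner_mult_left_adjoint\<close> this replaces the trace: a factor is moved to the
  other side of the inner product as its transpose, and the trace of a projection \<open>P\<close> is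
  \<open>hs_inner P P\<close>, because \<open>P\<^sup>T * P = P\<close>.
\<close>
lemma hs_inner_mult_right_adjoint:
  assumes A: "A \<in> carrier_mat n k" and B: "B \<in> carrier_mat k m" and C: "C \<in> carrier_mat n m"
  shows "hs_inner (A * B) C = hs_inner A (C * transpose_mat B)"
proof -
  have "hs_inner (A * B) C = (\<Sum>i<n. \<Sum>j<m. \<Sum>l<k. A $$ (i, l) * B $$ (l, j) * C $$ (i, j))"
    unfolding hs_inner_def using assms
    by (auto simp: mat_mult_index[OF A B] sum_distrib_right simp del: index_mult_mat(1))
  also have "\<dots> = (\<Sum>i<n. \<Sum>l<k. \<Sum>j<m. A $$ (i, l) * B $$ (l, j) * C $$ (i, j))"
    by (intro sum.cong refl sum.swap)
  also have "\<dots> = hs_inner A (C * transpose_mat B)"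
    unfolding hs_inner_def using assms
    by (auto simp: mat_mult_index[OF C iffD2[OF transpose_carrier_mat B]] sum_distrib_left mult_ac
        simp del: index_mult_mat(1) intro!: sum.cong)
  finally show ?thesis .
qed

lemma hs_inner_mult_left_adjoint:
  assumes A: "A \<in> carrier_mat n k" and B: "B \<in> carrier_mat k m" and C: "C \<in> carrier_mat n m"
  shows "hs_inner (A * B) C = hs_inner B (transpose_mat A * C)"
proof -
  have "hs_inner (A * B) C = hs_inner (transpose_mat B * transpose_mat A) (transpose_mat C)"
    using assms hs_inner_transpose[of "A * B" n m C] by (simp add: transpose_mult)
  also have "\<dots> = hs_inner (transpose_mat B) (transpose_mat C * A)"
    using assms by (subst hs_inner_mult_right_adjoint[of _ m k _ n]) auto
  also have "\<dots> = hs_inner (transpose_mat B) (transpose_mat (transpose_mat A * C))"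
    using assms by (simp add: transpose_mult)
  also have "\<dots> = hs_inner B (transpose_mat A * C)"
    using assms by (subst hs_inner_transpose) auto
  finally show ?thesis .
qed

lemma hs_inner_mult_le:
  assumes A: "A \<in> carrier_mat n k" and B: "B \<in> carrier_mat k m"
  shows "hs_inner (A * B) (A * B) \<le> hs_inner A A * hs_inner B B"
proof -
  have "hs_inner (A * B) (A * B) = (\<Sum>i<n. \<Sum>j<m. (\<Sum>l<k. A $$ (i, l) * B $$ (l, j))\<^sup>2)"
    unfolding hs_inner_def using assms
    by (auto simp: mat_mult_index[OF A B] power2_eq_square simp del: index_mult_mat(1))
  also have "\<dots> \<le> (\<Sum>i<n. \<Sum>j<m. (\<Sum>l<k. (A $$ (i, l))\<^sup>2) * (\<Sum>l<k. (B $$ (l, j))\<^sup>2))"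
    by (intro sum_mono Cauchy_Schwarz_ineq_sum)
  also have "\<dots> = (\<Sum>i<n. \<Sum>l<k. (A $$ (i, l))\<^sup>2) * (\<Sum>j<m. \<Sum>l<k. (B $$ (l, j))\<^sup>2)"
    by (simp add: sum_product)
  also have "(\<Sum>j<m. \<Sum>l<k. (B $$ (l, j))\<^sup>2) = (\<Sum>l<k. \<Sum>j<m. (B $$ (l, j))\<^sup>2)"
    by (rule sum.swap)
  finally show ?thesis unfolding hs_inner_def using assms by (auto simp: power2_eq_square)
qed

lemma hs_inner_one_mat: "hs_inner (1\<^sub>m k) (1\<^sub>m k) = real k"
proof -
  have "hs_inner (1\<^sub>m k) (1\<^sub>m k) = (\<Sum>i<k. \<Sum>j<k. if i = j then 1 else (0::real))"
    unfolding hs_inner_def index_one_mat(2,3) by (intro sum.cong refl) simp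
  then show ?thesis by simp
qed

section \<open>Orthogonal projections as symmetric idempotents\<close>

lemma scalar_prod_self_nonneg: "0 \<le> scalar_prod v (v :: real Matrix.vec)"
  unfolding scalar_prod_def by (intro sum_nonneg) simp

lemma scalar_prod_self_eq_0D:
  fixes v :: "real Matrix.vec"
  assumes v: "v \<in> carrier_vec n" and 0: "scalar_prod v v = 0"
  shows "v = 0\<^sub>v n"
proof -
  have "(\<Sum>i\<in>{0..<n}. v $ i * v $ i) = 0" using 0 v unfolding scalar_prod_def by simp
  then have "\<forall>i\<in>{0..<n}. v $ i * v $ i = 0"
    by (subst (asm) sum_nonneg_eq_0_iff) auto
  then show ?thesis using v by (intro eq_vecI) auto
qed

text \<open>
  Membership is a finite system of polynomial equations in the entries, which gives compactness
  and makes the perturbed projections easy to recognise. The last equation is \<open>trace P = r\<close>.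
\<close>
definition proj_mats :: "nat \<Rightarrow> nat \<Rightarrow> real mat set" where
  "proj_mats M r = {P \<in> carrier_mat M M. transpose_mat P = P \<and> P * P = P \<and> hs_inner P P = real r}"

lemma proj_matsD:
  assumes "P \<in> proj_mats M r"
  shows "P \<in> carrier_mat M M" "transpose_mat P = P" "P * P = P" "hs_inner P P = real r"
  using assms by (auto simp: proj_mats_def)

lemma range_subspace:
  fixes P :: "real mat"
  assumes P: "P \<in> carrier_mat M M"
  defines "V \<equiv> {y \<in> carrier_vec M. \<exists>x\<in>carrier_vec M. P *\<^sub>v x = y}"
  shows "VectorSpace.subspace class_ring V (module_vec TYPE(real) M)"
    and "vectorspace.fin_dim class_ring ((module_vec TYPE(real) M)\<lparr>carrier := V\<rparr>)"
proof -
  interpret vec_space "TYPE(real)" M .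
  have V: "V = span (set (cols P))"
    using col_space_eq[OF P] P unfolding V_def col_space_def by auto
  have c: "set (cols P) \<subseteq> carrier_vec M" using cols_dim[of P] P by auto
  show "VectorSpace.subspace class_ring V (module_vec TYPE(real) M)"
    unfolding V using c by (intro span_is_subspace) auto
  show "vectorspace.fin_dim class_ring ((module_vec TYPE(real) M)\<lparr>carrier := V\<rparr>)"
    unfolding V using fin_dim_span_cols[OF P] by simp
qed

text \<open>
  The trace of a projection is its rank. If the columns of \<open>B\<close> form a basis of the range, then
  \<open>P\<close> factors as \<open>B * A\<close>. From \<open>P * B = B\<close> and the injectivity of \<open>B\<close> one gets
  \<open>A * B = 1\<close>, so that \<open>tr P = tr (B * A) = tr (A * B)\<close> is the number of columns of \<open>B\<close>.
\<close>
lemma projection_energy_eq_dim: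
  fixes P :: "real mat"
  assumes P: "P \<in> carrier_mat M M" "transpose_mat P = P" "P * P = P"
  defines "V \<equiv> {y \<in> carrier_vec M. \<exists>x\<in>carrier_vec M. P *\<^sub>v x = y}"
  shows "hs_inner P P = real (vectorspace.dim class_ring ((module_vec TYPE(real) M)\<lparr>carrier := V\<rparr>))"
proof -
  interpret vec_space "TYPE(real)" M .
  have sub: "subspace class_ring V (module_vec TYPE(real) M)"
    using range_subspace(1)[OF P(1)] by (simp add: V_def)
  have fd: "vectorspace.fin_dim class_ring (vs V)"
    using range_subspace(2)[OF P(1)] by (simp add: V_def)
  interpret U: vectorspace class_ring "vs V" by (rule subspace_is_vs[OF sub])
  obtain \<beta> where fin: "finite \<beta>" and bas: "U.basis \<beta>"
    using U.finite_basis_exists[OF fd] by auto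
  have dim: "U.dim = card \<beta>" using U.dim_basis[OF fin bas] .
  have \<beta>V: "\<beta> \<subseteq> V" and gen: "U.span \<beta> = V" and li: "U.lin_indpt \<beta>"
    using bas by (auto simp: U.basis_def)
  have submod: "submodule class_ring V (module_vec TYPE(real) M)"
    using sub by (simp add: subspace_def)
  have gen': "span \<beta> = V" using span_li_not_depend(1)[OF \<beta>V submod] gen by simp
  have li': "lin_indpt \<beta>" using span_li_not_depend(2)[OF \<beta>V submod] li by simp
  obtain bs where bs: "set bs = \<beta>" "distinct bs" using finite_distinct_list[OF fin] by auto
  define k where "k = length bs"
  have kdim: "k = card \<beta>" using bs by (simp add: k_def distinct_card[symmetric])
  have bsc: "set bs \<subseteq> carrier_vec M" using \<beta>V bs by (auto simp: V_def)
  define B where "B = mat_of_cols M bs"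
  have B: "B \<in> carrier_mat M k" by (simp add: B_def k_def)
  have colsB: "cols B = bs" using bsc by (simp add: B_def)
  have rangeB: "V = {y \<in> carrier_vec M. \<exists>x\<in>carrier_vec k. B *\<^sub>v x = y}"
    using col_space_eq[OF B] B gen' bs by (auto simp: col_space_def colsB)
  have inj: "x = 0\<^sub>v k" if x: "x \<in> carrier_vec k" and Bx: "B *\<^sub>v x = 0\<^sub>v M" for x
  proof (rule ccontr)
    assume "x \<noteq> 0\<^sub>v k"
    then obtain i where i: "i < k" "x $ i \<noteq> 0" using x by (auto simp: vec_eq_iff)
    \<comment> \<open>Reindexes the coefficients by the basis vectors, since linear combinations range over sets.\<close>
    define f where "f = (\<lambda>v. x $ (THE i. i < k \<and> bs ! i = v))"
    have f: "f (bs ! j) = x $ j" if "j < k" for j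
    proof -
      have "(THE i. i < k \<and> bs ! i = bs ! j) = j"
        using that bs(2) by (intro the_equality) (auto simp: k_def nth_eq_iff_index_eq)
      then show ?thesis by (simp add: f_def)
    qed
    have "lincomb f (set bs) = lincomb_list (\<lambda>i. f (bs ! i)) bs"
      by (rule lincomb_as_lincomb_list_distinct[OF bsc bs(2)])
    also have "\<dots> = B *\<^sub>v Matrix.vec k (\<lambda>i. f (bs ! i))"
      unfolding B_def k_def by (rule lincomb_list_as_mat_mult) (use bsc in auto)
    also have "Matrix.vec k (\<lambda>i. f (bs ! i)) = x" using x f by (intro eq_vecI) auto
    finally have "lincomb f (set bs) = 0\<^sub>v M" using Bx by simp
    then have "lin_dep (set bs)"
      unfolding lin_dep_def
      by (intro exI[of _ "set bs"] exI[of _ f] exI[of _ "bs ! i"])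
         (use i f in \<open>auto simp: k_def\<close>)
    then show False using li' bs by simp
  qed
  have "\<exists>x. x \<in> carrier_vec k \<and> B *\<^sub>v x = col P j" if "j < M" for j
  proof -
    have "col P j = P *\<^sub>v unit_vec M j"
      using P(1) that by (intro eq_vecI) (auto simp: row_def)
    moreover have "P *\<^sub>v unit_vec M j \<in> V" using P(1) that by (auto simp: V_def)
    ultimately show ?thesis using rangeB by auto
  qed
  then obtain a where a: "\<And>j. j < M \<Longrightarrow> a j \<in> carrier_vec k \<and> B *\<^sub>v a j = col P j" by metis
  define A where "A = mat_of_cols k (map a [0..<M])"
  have A: "A \<in> carrier_mat k M" using mat_of_cols_carrier(1)[of k "map a [0..<M]"] by (simp add: A_def)
  have colA: "col A j = a j" if "j < M" for j
    using a that by (simp add: A_def)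
  have PBA: "P = B * A"
  proof (rule mat_col_eqI)
    fix j assume "j < dim_col (B * A)"
    then have j: "j < M" using A by simp
    show "col P j = col (B * A) j" using j a colA A B by (simp add: col_mult2[OF B A j])
  qed (use P A B in auto)
  have PB: "P * B = B"
  proof (rule mat_col_eqI)
    fix j assume "j < dim_col B"
    then have j: "j < k" using B by simp
    have "col B j \<in> V" using \<beta>V bs j colsB B by (metis cols_nth carrier_matD(2) k_def nth_mem subsetD)
    then obtain x where x: "x \<in> carrier_vec M" "P *\<^sub>v x = col B j" by (auto simp: V_def)
    have "P *\<^sub>v col B j = (P * P) *\<^sub>v x" using x P(1) by (simp add: assoc_mult_mat_vec[OF P(1) P(1)] flip: x(2))
    then show "col (P * B) j = col B j" using x P j B by (simp add: col_mult2[OF P(1) B j])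
  qed (use P B in auto)
  have AB: "A * B = 1\<^sub>m k"
  proof (rule mat_col_eqI)
    fix j assume "j < dim_col (1\<^sub>m k :: real mat)"
    then have j: "j < k" by simp
    have ABc: "A * B \<in> carrier_mat k k" using A B by simp
    have c1: "col (A * B) j \<in> carrier_vec k" using ABc j by auto
    have c2: "B * (A * B) = B" using PB A B by (simp add: PBA assoc_mult_mat[OF B A B])
    have "B *\<^sub>v col (A * B) j = col (B * (A * B)) j" by (simp add: col_mult2[OF B ABc j])
    also have "\<dots> = col (B * 1\<^sub>m k) j" using c2 B by simp
    also have "\<dots> = B *\<^sub>v unit_vec k j" using B j by (subst col_mult2[OF B one_carrier_mat j]) simp
    finally have e: "B *\<^sub>v col (A * B) j = B *\<^sub>v unit_vec k j" .
    have "B *\<^sub>v (col (A * B) j - unit_vec k j) = 0\<^sub>v M"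
      using e c1 B by (subst mult_minus_distrib_mat_vec[OF B]) auto
    then have "col (A * B) j - unit_vec k j = 0\<^sub>v k" by (intro inj) (use c1 in auto)
    then have "col (A * B) j = unit_vec k j" using c1 A by (auto simp: vec_eq_iff)
    then show "col (A * B) j = col (1\<^sub>m k) j" using j by simp
  qed (use A B in auto)
  \<comment> \<open>The cyclicity of the trace, in terms of adjoints.\<close>
  have "hs_inner P P = hs_inner (P * 1\<^sub>m M) (P)" using P(1) by simp
  also have "\<dots> = hs_inner (1\<^sub>m M) (transpose_mat P * P)"
    using P(1) by (intro hs_inner_mult_left_adjoint) auto
  also have "\<dots> = hs_inner (1\<^sub>m M) (B * A)" using P by (simp flip: PBA)
  also have "\<dots> = hs_inner (B * A) (1\<^sub>m M)"
    using A B by (intro hs_inner_commute) auto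
  also have "\<dots> = hs_inner A (transpose_mat B * 1\<^sub>m M)"
    using A B by (intro hs_inner_mult_left_adjoint) auto
  also have "\<dots> = hs_inner A (1\<^sub>m k * transpose_mat B)"
    using A B by simp
  also have "\<dots> = hs_inner (A * B) (1\<^sub>m k)"
    using A B by (intro hs_inner_mult_right_adjoint[symmetric]) auto
  also have "\<dots> = real k" by (simp add: AB hs_inner_one_mat)
  finally show ?thesis using dim kdim by simp
qed

text \<open>
  If \<open>P\<close> projects orthogonally onto \<open>V\<close>, then for \<open>w\<close> in \<open>V\<close> the residual \<open>w - P w\<close> is in
  \<open>V\<close> and orthogonal to \<open>V\<close>, hence zero. So \<open>V\<close> is the range of \<open>P\<close> and \<open>P\<close> is
  idempotent; symmetry follows by testing residuals against values of \<open>P\<close>.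
\<close>
lemma orth_projs_eq: "orth_projs M r = proj_mats M r"
proof (intro subset_antisym subsetI)
  fix P assume "P \<in> proj_mats M r"
  note P = proj_matsD[OF this]
  define V where "V = {y \<in> carrier_vec M. \<exists>x\<in>carrier_vec M. P *\<^sub>v x = y}"
  have "orth_proj_onto M V P" unfolding orth_proj_onto_def
  proof (intro conjI ballI P(1))
    fix x :: "real Matrix.vec" assume x: "x \<in> carrier_vec M"
    show "P *\<^sub>v x \<in> V" using P(1) x by (auto simp: V_def)
    fix w assume "w \<in> V"
    then obtain y where y: "y \<in> carrier_vec M" "w = P *\<^sub>v y" by (auto simp: V_def)
    have z: "x - P *\<^sub>v x \<in> carrier_vec M" using x P(1) by simp
    have "scalar_prod (x - P *\<^sub>v x) w = scalar_prod (transpose_mat P *\<^sub>v (x - P *\<^sub>v x)) y"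
      unfolding y(2) using transpose_vec_mult_scalar[OF P(1) y(1) z] by simp
    also have "transpose_mat P *\<^sub>v (x - P *\<^sub>v x) = 0\<^sub>v M"
      using x P(1) P(2,3) assoc_mult_mat_vec[OF P(1) P(1) x]
      by (simp add: mult_minus_distrib_mat_vec[OF P(1)])
    finally show "scalar_prod (x - P *\<^sub>v x) w = 0" using y by simp
  qed
  moreover have "vectorspace.dim class_ring ((module_vec TYPE(real) M)\<lparr>carrier := V\<rparr>) = r"
    using projection_energy_eq_dim[OF P(1,2,3)] P(4) by (simp add: V_def)
  ultimately show "P \<in> orth_projs M r"
    using range_subspace(1)[OF P(1)] unfolding orth_projs_def V_def by blast
next
  fix P assume "P \<in> orth_projs M r"
  then obtain V where sub: "VectorSpace.subspace class_ring V (module_vec TYPE(real) M)"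
    and dim: "vectorspace.dim class_ring ((module_vec TYPE(real) M)\<lparr>carrier := V\<rparr>) = r"
    and o: "orth_proj_onto M V P" unfolding orth_projs_def by blast
  interpret vec_space "TYPE(real)" M .
  have P: "P \<in> carrier_mat M M" using o by (simp add: orth_proj_onto_def)
  have PV: "P *\<^sub>v x \<in> V" and orth: "w \<in> V \<Longrightarrow> scalar_prod (x - P *\<^sub>v x) w = 0"
    if "x \<in> carrier_vec M" for x w using o that by (auto simp: orth_proj_onto_def)
  have submod: "submodule class_ring V (module_vec TYPE(real) M)"
    using sub by (simp add: subspace_def)
  have Vc: "V \<subseteq> carrier_vec M" using submod by (auto simp: submodule_def)
  have Px: "P *\<^sub>v x \<in> carrier_vec M" if "x \<in> carrier_vec M" for x using P that by simp
  have fixV: "P *\<^sub>v w = w" if w: "w \<in> V" for w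
  proof -
    have wc: "w \<in> carrier_vec M" using w Vc by auto
    let ?d = "w - P *\<^sub>v w"
    have d: "?d \<in> carrier_vec M" using wc P by simp
    have "scalar_prod ?d ?d = scalar_prod ?d w - scalar_prod ?d (P *\<^sub>v w)"
      using wc d Px by (subst scalar_prod_minus_distrib) auto
    also have "\<dots> = 0" using orth[OF wc w] orth[OF wc PV[OF wc]] by simp
    finally have "?d = 0\<^sub>v M" by (rule scalar_prod_self_eq_0D[OF d])
    then show ?thesis using wc P by (auto simp: vec_eq_iff)
  qed
  have sym: "scalar_prod (P *\<^sub>v x) y = scalar_prod x (P *\<^sub>v y)"
    if x: "x \<in> carrier_vec M" and y: "y \<in> carrier_vec M" for x y
  proof -
    have "scalar_prod (x - P *\<^sub>v x) (P *\<^sub>v y) = 0" "scalar_prod (y - P *\<^sub>v y) (P *\<^sub>v x) = 0"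
      using orth PV x y by auto
    then have "scalar_prod x (P *\<^sub>v y) = scalar_prod (P *\<^sub>v x) (P *\<^sub>v y)"
      "scalar_prod y (P *\<^sub>v x) = scalar_prod (P *\<^sub>v y) (P *\<^sub>v x)"
      using x y Px by (simp_all add: minus_scalar_prod_distrib[of _ M])
    then show ?thesis using x y Px by (metis comm_scalar_prod)
  qed
  have t: "transpose_mat P = P"
  proof (rule eq_matI)
    fix i j assume "i < dim_row P" "j < dim_col P"
    then have ij: "i < M" "j < M" using P by auto
    have "scalar_prod (P *\<^sub>v unit_vec M i) (unit_vec M j) = P $$ (j, i)"
      "scalar_prod (unit_vec M i) (P *\<^sub>v unit_vec M j) = P $$ (i, j)"
      using ij P by (auto simp: row_def)
    then show "transpose_mat P $$ (i, j) = P $$ (i, j)" using sym[of "unit_vec M i" "unit_vec M j"] ij P by simp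
  qed (use P in auto)
  have i: "P * P = P"
  proof (rule mat_col_eqI)
    fix j assume "j < dim_col P"
    then have j: "j < M" using P by auto
    have "col P j = P *\<^sub>v unit_vec M j" using P j by (intro eq_vecI) (auto simp: row_def)
    then show "col (P * P) j = col P j"
      using fixV[OF PV[of "unit_vec M j"]] j by (simp add: col_mult2[OF P P j])
  qed auto
  have V: "V = {y \<in> carrier_vec M. \<exists>x\<in>carrier_vec M. P *\<^sub>v x = y}"
    using PV fixV Vc by force
  show "P \<in> proj_mats M r"
    using projection_energy_eq_dim[OF P t i] dim P t i unfolding V proj_mats_def by simp
qed

section \<open>The maximal projected energy\<close>

text \<open>
  Picking one point from each member of a countable base of \<open>S\<close> gives a countable dense subset,
  in the form used here: a continuous function has the same supremum over \<open>D\<close> as over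
  \<open>S\<close>. It makes the maximal energy a countable supremum, hence measurable.
\<close>
lemma countable_subset_witnessing_continuous:
  fixes S :: "'a::second_countable_topology set"
  obtains D where "countable D" "D \<subseteq> S"
    "\<And>(g :: 'a \<Rightarrow> real) x a. continuous_on S g \<Longrightarrow> x \<in> S \<Longrightarrow> a < g x \<Longrightarrow> \<exists>d\<in>D. a < g d"
proof -
  obtain \<B> :: "'a set set" where B: "countable \<B>" "{} \<notin> \<B>"
    "\<And>C. C \<in> \<B> \<Longrightarrow> openin (top_of_set S) C"
    "\<And>T. openin (top_of_set S) T \<Longrightarrow> \<exists>\<U>. \<U> \<subseteq> \<B> \<and> T = \<Union>\<U>"
    by (rule subset_second_countable[of S]) (assumption | rule that)+
  define p where "p = (\<lambda>C::'a set. SOME x. x \<in> C)"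
  have p: "p C \<in> C" if "C \<in> \<B>" for C
  proof -
    have "C \<noteq> {}" using that B(2) by blast
    then show ?thesis unfolding p_def by (rule some_in_eq[THEN iffD2])
  qed
  show ?thesis
  proof (rule that[of "p ` \<B>"])
    show "countable (p ` \<B>)" using B(1) by simp
    show "p ` \<B> \<subseteq> S"
    proof clarify
      fix C assume "C \<in> \<B>"
      then show "p C \<in> S" using p[of C] openin_imp_subset[OF B(3)[of C]] by blast
    qed
    fix g :: "'a \<Rightarrow> real" and x a
    assume g: "continuous_on S g" and x: "x \<in> S" "a < g x"
    have "openin (top_of_set S) (S \<inter> g -` {a<..})"
      by (rule continuous_openin_preimage_gen[OF g]) simp
    from B(4)[OF this] obtain \<U> where U: "\<U> \<subseteq> \<B>" "S \<inter> g -` {a<..} = \<Union>\<U>"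
      by (elim exE conjE)
    have "x \<in> \<Union>\<U>" using x unfolding U(2)[symmetric] by simp
    then obtain C where "C \<in> \<U>" "x \<in> C" by (rule UnionE)
    then have C: "C \<in> \<B>" "C \<subseteq> S \<inter> g -` {a<..}" using U by auto
    then have "a < g (p C)" using p[OF C(1)] by auto
    then show "\<exists>d\<in>p ` \<B>. a < g d" using C(1) by blast
  qed
qed

text \<open>
  The same projections as points of the product space of entry functions, where Tychonoff's
  theorem applies; entries outside the matrix are fixed to \<open>0\<close> to keep the set bounded.
\<close>
definition proj_funs :: "nat \<Rightarrow> nat \<Rightarrow> (nat \<times> nat \<Rightarrow> real) set" where
  "proj_funs M r = {f. (\<forall>p. p \<notin> {..<M} \<times> {..<M} \<longrightarrow> f p = 0) \<and> Matrix.mat M M f \<in> proj_mats M r}"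

lemma proj_mats_eq_image: "proj_mats M r = Matrix.mat M M ` proj_funs M r"
proof (intro subset_antisym subsetI)
  fix P assume P: "P \<in> proj_mats M r"
  define f where "f = (\<lambda>p. if p \<in> {..<M} \<times> {..<M} then P $$ p else 0)"
  have e: "Matrix.mat M M f = P" using proj_matsD(1)[OF P] by (intro eq_matI) (simp_all add: f_def)
  have "f \<in> proj_funs M r" unfolding proj_funs_def mem_Collect_eq e using P by (simp add: f_def)
  then show "P \<in> Matrix.mat M M ` proj_funs M r" unfolding e[symmetric] by (rule imageI)
qed (auto simp: proj_funs_def)

lemma continuous_on_coordinate_UNIV [continuous_intros]:
  "continuous_on UNIV (\<lambda>f :: 'a \<Rightarrow> real. f p)"
  by simp

lemma proj_funs_eq:
  "proj_funs M r =
    {f. (\<forall>p. p \<notin> {..<M} \<times> {..<M} \<longrightarrow> f p = 0) \<and>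
        (\<forall>i j. i < M \<longrightarrow> j < M \<longrightarrow> f (j, i) = f (i, j)) \<and>
        (\<forall>i j. i < M \<longrightarrow> j < M \<longrightarrow> (\<Sum>l<M. f (i, l) * f (l, j)) = f (i, j)) \<and>
        (\<Sum>i<M. \<Sum>j<M. f (i, j) * f (i, j)) = real r}"
proof -
  have 1: "transpose_mat (Matrix.mat M M f) = Matrix.mat M M f \<longleftrightarrow>
      (\<forall>i j. i < M \<longrightarrow> j < M \<longrightarrow> f (j, i) = f (i, j))" for f :: "nat \<times> nat \<Rightarrow> real"
    by (simp add: mat_eq_iff)
  have m: "(Matrix.mat M M f * Matrix.mat M M f) $$ (i, j) = (\<Sum>l<M. f (i, l) * f (l, j))"
    if "i < M" "j < M" for f :: "nat \<times> nat \<Rightarrow> real" and i j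
    using that by (subst mat_mult_index[of _ M M _ M]) simp_all
  have 2: "Matrix.mat M M f * Matrix.mat M M f = Matrix.mat M M f \<longleftrightarrow>
      (\<forall>i j. i < M \<longrightarrow> j < M \<longrightarrow> (\<Sum>l<M. f (i, l) * f (l, j)) = f (i, j))"
    for f :: "nat \<times> nat \<Rightarrow> real"
    by (simp add: mat_eq_iff m del: index_mult_mat(1))
  have 3: "hs_inner (Matrix.mat M M f) (Matrix.mat M M f) = (\<Sum>i<M. \<Sum>j<M. f (i, j) * f (i, j))"
    for f :: "nat \<times> nat \<Rightarrow> real"
    unfolding hs_inner_def dim_row_mat dim_col_mat by (intro sum.cong refl) simp
  show ?thesis unfolding proj_funs_def proj_mats_def mem_Collect_eq 1 2 3 by simp
qed

text \<open>
  Closed, as it is cut out by equations, and inside a cube: the squares of the entries add up to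
  \<open>r\<close>.
\<close>
lemma compact_proj_funs: "compact (proj_funs M r)"
proof -
  let ?B = "PiE UNIV (\<lambda>_::nat\<times>nat. {-(1 + real r)..1 + real r})"
  have "compactin (product_topology (\<lambda>_::nat\<times>nat. euclidean::real topology) UNIV) ?B"
    by (subst compactin_PiE) simp
  then have c: "compact ?B"
    unfolding euclidean_product_topology by simp
  have "closed (proj_funs M r)"
    unfolding proj_funs_eq
    by (intro closed_Collect_conj closed_Collect_all closed_Collect_imp closed_Collect_eq
        open_Collect_const continuous_intros)
  moreover have "proj_funs M r \<subseteq> ?B"
  proof
    fix f assume f: "f \<in> proj_funs M r"
    have "\<bar>f p\<bar> \<le> 1 + real r" for p
    proof (cases "p \<in> {..<M} \<times> {..<M}")
      case True
      have "(f p)\<^sup>2 \<le> (\<Sum>q\<in>{..<M}\<times>{..<M}. (f q)\<^sup>2)"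
        by (rule member_le_sum[OF True]) auto
      also have "\<dots> = real r"
        using f unfolding proj_funs_eq by (simp add: sum.cartesian_product power2_eq_square)
      also have "\<dots> \<le> (1 + real r)\<^sup>2" by (simp add: power2_eq_square algebra_simps)
      finally show ?thesis by (simp add: abs_le_square_iff[symmetric])
    next
      case False
      then have "f p = 0" using f unfolding proj_funs_def by blast
      then show ?thesis by simp
    qed
    then have "f p \<in> {-(1 + real r)..1 + real r}" for p
      using abs_le_iff[of "f p" "1 + real r"] by (metis atLeastAtMost_iff minus_le_iff)
    then show "f \<in> ?B" by (simp add: PiE_UNIV_domain)
  qed
  ultimately show ?thesis using c by (metis compact_Int_closed inf.absorb_iff2)
qed

text \<open>
  The energy is linear in \<open>P\<close>, whence its continuity in the entries of \<open>P\<close>.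
\<close>
lemma proj_quadratic:
  assumes P: "P \<in> proj_mats M r" and X: "X \<in> carrier_mat M m"
  shows "hs_inner (P * X) (P * X) = hs_inner (P * X) X"
proof -
  note p = proj_matsD[OF P]
  have "hs_inner (P * X) (P * X) = hs_inner X (P * (P * X))"
    using p X by (subst hs_inner_mult_left_adjoint[of _ M M _ m]) auto
  also have "\<dots> = hs_inner X (P * X)"
    using p(1,3) X by (simp flip: assoc_mult_mat[OF p(1,1) X])
  also have "\<dots> = hs_inner (P * X) X" using p X by (intro hs_inner_commute) auto
  finally show ?thesis .
qed

lemma continuous_on_proj_energy:
  assumes "X \<in> carrier_mat M M"
  shows "continuous_on UNIV (\<lambda>f. hs_inner (Matrix.mat M M f * X) X)"
proof -
  have "hs_inner (Matrix.mat M M f * X) X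
     = (\<Sum>i<M. \<Sum>j<M. (\<Sum>l<M. f (i, l) * X $$ (l, j)) * X $$ (i, j))" for f
    unfolding hs_inner_def using assms
    by (auto simp: scalar_prod_def lessThan_atLeast0 intro!: sum.cong)
  then show ?thesis by (simp, intro continuous_intros)
qed

lemma proj_energy_max_exists:
  assumes ne: "proj_mats M r \<noteq> {}" and X: "X \<in> carrier_mat M M"
  obtains P where "P \<in> proj_mats M r"
    "\<And>Q. Q \<in> proj_mats M r \<Longrightarrow> hs_inner (Q * X) (Q * X) \<le> hs_inner (P * X) (P * X)"
proof -
  have "proj_funs M r \<noteq> {}" using ne by (simp add: proj_mats_eq_image)
  from continuous_attains_sup[OF compact_proj_funs this
        continuous_on_subset[OF continuous_on_proj_energy[OF X] subset_UNIV]]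
  obtain f where f: "f \<in> proj_funs M r" and
    max: "\<And>g. g \<in> proj_funs M r \<Longrightarrow>
      hs_inner (Matrix.mat M M g * X) X \<le> hs_inner (Matrix.mat M M f * X) X"
    by auto
  show ?thesis
  proof (rule that)
    show P: "Matrix.mat M M f \<in> proj_mats M r" using f by (simp add: proj_mats_eq_image)
    fix Q assume Q: "Q \<in> proj_mats M r"
    then obtain g where g: "g \<in> proj_funs M r" "Q = Matrix.mat M M g"
      unfolding proj_mats_eq_image by (rule imageE)
    show "hs_inner (Q * X) (Q * X) \<le> hs_inner (Matrix.mat M M f * X) (Matrix.mat M M f * X)"
      unfolding proj_quadratic[OF Q X] proj_quadratic[OF P X] unfolding g(2) by (rule max[OF g(1)])
  qed
qed

lemma empirical_proj:
  assumes ne: "proj_mats M r \<noteq> {}" and X: "X \<in> carrier_mat M M"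
  shows empirical_proj_in: "empirical_proj M r X \<in> proj_mats M r"
    and empirical_proj_max: "Q \<in> proj_mats M r \<Longrightarrow>
      hs_inner (Q * X) (Q * X) \<le> hs_inner (empirical_proj M r X * X) (empirical_proj M r X * X)"
proof -
  obtain P where P: "P \<in> proj_mats M r"
    "\<And>Q. Q\<in>proj_mats M r \<Longrightarrow> hs_inner (Q * X) (Q * X) \<le> hs_inner (P * X) (P * X)"
    by (rule proj_energy_max_exists[OF assms]) (rule that)
  have e: "empirical_proj M r X = arg_max (\<lambda>P. hs_inner (P * X) (P * X)) (\<lambda>P. P \<in> proj_mats M r)"
    unfolding empirical_proj_def arg_max_on_def hs_norm_sq orth_projs_eq ..
  have "is_arg_max (\<lambda>P. hs_inner (P * X) (P * X)) (\<lambda>P. P \<in> proj_mats M r) P"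
    unfolding is_arg_max_linorder using P by simp
  then have "is_arg_max (\<lambda>P. hs_inner (P * X) (P * X)) (\<lambda>P. P \<in> proj_mats M r) (empirical_proj M r X)"
    unfolding e arg_max_def by (rule someI)
  then show "empirical_proj M r X \<in> proj_mats M r"
    and "Q \<in> proj_mats M r \<Longrightarrow>
      hs_inner (Q * X) (Q * X) \<le> hs_inner (empirical_proj M r X * X) (empirical_proj M r X * X)"
    unfolding is_arg_max_linorder by simp_all
qed

lemma measurable_gaussian_coordinate [measurable]:
  "p \<in> {..<M} \<times> {..<M} \<Longrightarrow> (\<lambda>\<omega>. \<omega> p) \<in> borel_measurable (gaussian_law M \<sigma>)"
  unfolding gaussian_law_def
  using measurable_component_singleton[of p "{..<M} \<times> {..<M}"
      "\<lambda>_. density lborel (\<lambda>x. ennreal (normal_density 0 \<sigma> x))"] by simp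

lemma observation_carrier [simp]:
  "C \<in> carrier_mat M M \<Longrightarrow> observation C M \<omega> \<in> carrier_mat M M"
  by (simp add: observation_def)

lemma measurable_hs_inner_mult_observation:
  assumes "A \<in> carrier_mat M M" "C \<in> carrier_mat M M"
  shows "(\<lambda>\<omega>. hs_inner (A * observation C M \<omega>) (observation C M \<omega>)) \<in> borel_measurable (gaussian_law M \<sigma>)"
proof -
  have "hs_inner (A * observation C M \<omega>) (observation C M \<omega>) =
     (\<Sum>i<M. \<Sum>j<M. (\<Sum>l<M. A $$ (i, l) * (C $$ (l, j) + \<omega> (l, j))) * (C $$ (i, j) + \<omega> (i, j)))" for \<omega>
    unfolding hs_inner_def using assms
    by (auto simp: scalar_prod_def lessThan_atLeast0 observation_def intro!: sum.cong)
  then show ?thesis by (simp, measurable)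
qed

lemma measurable_empirical_energy:
  assumes ne: "proj_mats M r \<noteq> {}" and C: "C \<in> carrier_mat M M"
  shows "(\<lambda>\<omega>. hs_inner (empirical_proj M r (observation C M \<omega>) * observation C M \<omega>)
            (empirical_proj M r (observation C M \<omega>) * observation C M \<omega>))
          \<in> borel_measurable (gaussian_law M \<sigma>)"
proof -
  let ?X = "observation C M"
  let ?m = "\<lambda>\<omega>. hs_inner (empirical_proj M r (?X \<omega>) * ?X \<omega>) (empirical_proj M r (?X \<omega>) * ?X \<omega>)"
  obtain D where D: "countable D" "D \<subseteq> proj_funs M r"
    "\<And>(g :: _ \<Rightarrow> real) x a. continuous_on (proj_funs M r) g \<Longrightarrow> x \<in> proj_funs M r \<Longrightarrow> a < g x \<Longrightarrow>
       \<exists>d\<in>D. a < g d"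
    by (rule countable_subset_witnessing_continuous[of "proj_funs M r"]) (rule that)
  let ?g = "\<lambda>f \<omega>. hs_inner (Matrix.mat M M f * ?X \<omega>) (?X \<omega>)"
  have le: "?g f \<omega> \<le> ?m \<omega>" if "f \<in> D" for f \<omega>
  proof -
    have P: "Matrix.mat M M f \<in> proj_mats M r" using that D(2) unfolding proj_mats_eq_image by blast
    from empirical_proj_max[OF ne observation_carrier[OF C] P, of \<omega>]
    show ?thesis unfolding proj_quadratic[OF P observation_carrier[OF C]] .
  qed
  have witness: "\<exists>d\<in>D. a < ?g d \<omega>" if "a < ?m \<omega>" for a \<omega>
  proof -
    have c: "continuous_on (proj_funs M r) (\<lambda>f. ?g f \<omega>)"
      by (rule continuous_on_subset[OF continuous_on_proj_energy[OF observation_carrier[OF C]] subset_UNIV])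
    have P: "empirical_proj M r (?X \<omega>) \<in> proj_mats M r"
      by (rule empirical_proj_in[OF ne observation_carrier[OF C]])
    then obtain f where f: "f \<in> proj_funs M r" "empirical_proj M r (?X \<omega>) = Matrix.mat M M f"
      unfolding proj_mats_eq_image by (elim imageE)
    have "?m \<omega> = ?g f \<omega>"
      unfolding proj_quadratic[OF P observation_carrier[OF C]] unfolding f(2) ..
    then show ?thesis using D(3)[OF c f(1), of a] that by simp
  qed
  have ne_D: "D \<noteq> {}"
  proof
    assume "D = {}"
    then show False using witness[of "?m (\<lambda>_. 0) - 1" "\<lambda>_. 0"] by simp
  qed
  have bdd: "bdd_above ((\<lambda>f. ?g f \<omega>) ` D)" for \<omega> using le by (intro bdd_aboveI2) auto
  have "?m = (\<lambda>\<omega>. SUP f\<in>D. ?g f \<omega>)"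
  proof
    fix \<omega>
    show "?m \<omega> = (SUP f\<in>D. ?g f \<omega>)"
    proof (rule antisym)
      show "(SUP f\<in>D. ?g f \<omega>) \<le> ?m \<omega>" using ne_D le by (intro cSUP_least) auto
      show "?m \<omega> \<le> (SUP f\<in>D. ?g f \<omega>)"
      proof (rule dense_le)
        fix a assume "a < ?m \<omega>"
        then obtain d where "d \<in> D" "a < ?g d \<omega>" using witness by blast
        then show "a \<le> (SUP f\<in>D. ?g f \<omega>)" using cSUP_upper[OF _ bdd, of d] by (meson less_imp_le order_trans)
      qed
    qed
  qed
  moreover have "(\<lambda>\<omega>. SUP f\<in>D. ?g f \<omega>) \<in> borel_measurable (gaussian_law M \<sigma>)"
    using D(1) bdd C
    by (intro borel_measurable_cSUP measurable_hs_inner_mult_observation) simp_all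
  ultimately show ?thesis by simp
qed

section \<open>Moments of Gaussian noise\<close>

abbreviation normal_law :: "real \<Rightarrow> real measure" where
  "normal_law \<sigma> \<equiv> density lborel (\<lambda>x. ennreal (normal_density 0 \<sigma> x))"

lemma prob_space_normal_law: "\<sigma> > 0 \<Longrightarrow> prob_space (normal_law \<sigma>)"
  by (rule prob_space_normal_density)

lemma prob_space_gaussian_law: "\<sigma> > 0 \<Longrightarrow> prob_space (gaussian_law M \<sigma>)"
  unfolding gaussian_law_def by (intro prob_space_PiM prob_space_normal_law)

lemma normal_law_power:
  assumes "\<sigma> > 0"
  shows "integrable (normal_law \<sigma>) (\<lambda>x. x ^ k)"
    and "(\<integral>x. x ^ k \<partial>normal_law \<sigma>) = (\<integral>x. normal_density 0 \<sigma> x * x ^ k \<partial>lborel)"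
proof -
  show "integrable (normal_law \<sigma>) (\<lambda>x. x ^ k)"
    using integrable_normal_moment[OF assms, of 0 k]
    by (subst integrable_density) auto
  show "(\<integral>x. x ^ k \<partial>normal_law \<sigma>) = (\<integral>x. normal_density 0 \<sigma> x * x ^ k \<partial>lborel)"
    by (subst integral_density) auto
qed

lemma normal_law_moments:
  assumes "\<sigma> > 0"
  shows "(\<integral>x. x ^ 0 \<partial>normal_law \<sigma>) = 1" "(\<integral>x. x ^ Suc 0 \<partial>normal_law \<sigma>) = 0"
    "(\<integral>x. x ^ 2 \<partial>normal_law \<sigma>) = \<sigma>\<^sup>2"
proof -
  show "(\<integral>x. x ^ 0 \<partial>normal_law \<sigma>) = 1"
    unfolding normal_law_power(2)[OF assms] using assms by simp
  show "(\<integral>x. x ^ Suc 0 \<partial>normal_law \<sigma>) = 0"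
    unfolding normal_law_power(2)[OF assms] using integral_normal_moment_odd[OF assms, of 0 0] by simp
  show "(\<integral>x. x ^ 2 \<partial>normal_law \<sigma>) = \<sigma>\<^sup>2"
    unfolding normal_law_power(2)[OF assms] using integral_normal_moment_even[OF assms, of 0 1]
    by (simp add: power2_eq_square)
qed

text \<open>
  Completing the square turns the tilted density into a multiple of a shifted normal density.
\<close>
lemma normal_law_exp:
  assumes "\<sigma> > 0"
  shows "integrable (normal_law \<sigma>) (\<lambda>x. exp (c * x))"
    and "(\<integral>x. exp (c * x) \<partial>normal_law \<sigma>) = exp (\<sigma>\<^sup>2 / 2 * c\<^sup>2)"
proof -
  have e: "normal_density 0 \<sigma> x * exp (c * x) = exp (\<sigma>\<^sup>2 / 2 * c\<^sup>2) * normal_density (\<sigma>\<^sup>2 * c) \<sigma> x" for x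
  proof -
    have "-(x - 0)\<^sup>2 / (2 * \<sigma>\<^sup>2) + c * x = \<sigma>\<^sup>2 / 2 * c\<^sup>2 + -(x - \<sigma>\<^sup>2 * c)\<^sup>2 / (2 * \<sigma>\<^sup>2)"
      using assms by (simp add: field_simps power2_eq_square)
    then have "exp (-(x - 0)\<^sup>2 / (2 * \<sigma>\<^sup>2)) * exp (c * x)
        = exp (\<sigma>\<^sup>2 / 2 * c\<^sup>2) * exp (-(x - \<sigma>\<^sup>2 * c)\<^sup>2 / (2 * \<sigma>\<^sup>2))"
      by (simp only: exp_add[symmetric])
    then show ?thesis unfolding normal_density_def by (simp add: mult_ac)
  qed
  show "integrable (normal_law \<sigma>) (\<lambda>x. exp (c * x))"
    using assms by (subst integrable_density) (auto simp: e)
  show "(\<integral>x. exp (c * x) \<partial>normal_law \<sigma>) = exp (\<sigma>\<^sup>2 / 2 * c\<^sup>2)"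
    using assms by (subst integral_density) (auto simp: e)
qed

lemma gaussian_law_product:
  fixes f :: "nat \<times> nat \<Rightarrow> real \<Rightarrow> real"
  assumes "\<sigma> > 0" and f: "\<And>p. p \<in> {..<M} \<times> {..<M} \<Longrightarrow> integrable (normal_law \<sigma>) (f p)"
  shows "integrable (gaussian_law M \<sigma>) (\<lambda>\<omega>. \<Prod>p\<in>{..<M} \<times> {..<M}. f p (\<omega> p))"
    and "(\<integral>\<omega>. (\<Prod>p\<in>{..<M} \<times> {..<M}. f p (\<omega> p)) \<partial>gaussian_law M \<sigma>)
          = (\<Prod>p\<in>{..<M} \<times> {..<M}. \<integral>x. f p x \<partial>normal_law \<sigma>)"
proof -
  interpret prob_space "normal_law \<sigma>" by (rule prob_space_normal_law[OF assms(1)])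
  interpret product_sigma_finite "\<lambda>_::nat\<times>nat. normal_law \<sigma>"
    by (intro product_sigma_finite.intro sigma_finite_measure_axioms)
  show "integrable (gaussian_law M \<sigma>) (\<lambda>\<omega>. \<Prod>p\<in>{..<M} \<times> {..<M}. f p (\<omega> p))"
    unfolding gaussian_law_def using f by (intro product_integrable_prod) auto
  show "(\<integral>\<omega>. (\<Prod>p\<in>{..<M} \<times> {..<M}. f p (\<omega> p)) \<partial>gaussian_law M \<sigma>)
          = (\<Prod>p\<in>{..<M} \<times> {..<M}. \<integral>x. f p x \<partial>normal_law \<sigma>)"
    unfolding gaussian_law_def using f by (intro product_integral_prod) auto
qed

lemma gaussian_law_exp_linear:
  assumes "\<sigma> > 0"
  shows "integrable (gaussian_law M \<sigma>) (\<lambda>\<omega>. exp (\<Sum>p\<in>{..<M} \<times> {..<M}. c p * \<omega> p))"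
    and "(\<integral>\<omega>. exp (\<Sum>p\<in>{..<M} \<times> {..<M}. c p * \<omega> p) \<partial>gaussian_law M \<sigma>)
          = exp (\<sigma>\<^sup>2 / 2 * (\<Sum>p\<in>{..<M} \<times> {..<M}. (c p)\<^sup>2))"
  using gaussian_law_product[OF assms, of M "\<lambda>p x. exp (c p * x)"] normal_law_exp[OF assms]
  by (simp_all add: exp_sum sum_distrib_left)

lemma prod_power_indicator:
  fixes \<omega> :: "'a \<Rightarrow> real"
  assumes "finite A" "p \<in> A"
  shows "(\<Prod>r\<in>A. \<omega> r ^ (if r = p then k else 0)) = \<omega> p ^ k"
proof -
  have "(\<Prod>r\<in>A. \<omega> r ^ (if r = p then k else 0)) = (\<Prod>r\<in>A. if r = p then \<omega> r ^ k else 1)"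
    by (intro prod.cong) auto
  then show ?thesis using assms by simp
qed

lemma gaussian_law_monomial_integrable:
  assumes "\<sigma> > 0" "p \<in> {..<M} \<times> {..<M}" "q \<in> {..<M} \<times> {..<M}"
  shows "integrable (gaussian_law M \<sigma>) (\<lambda>\<omega>. \<omega> p ^ k * \<omega> q ^ l)"
proof -
  \<comment> \<open>Exponents add up when \<open>p\<close> and \<open>q\<close> coincide.\<close>
  let ?e = "\<lambda>r. (if r = p then k else 0) + (if r = q then l else 0)"
  have "(\<Prod>r\<in>{..<M} \<times> {..<M}. \<omega> r ^ ?e r) = \<omega> p ^ k * \<omega> q ^ l" for \<omega> :: "nat \<times> nat \<Rightarrow> real"
    unfolding power_add prod.distrib using assms(2,3) by (simp add: prod_power_indicator)
  then show ?thesis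
    using gaussian_law_product(1)[OF assms(1), of M "\<lambda>r x. x ^ ?e r"] normal_law_power(1)[OF assms(1)]
    by simp
qed

lemma gaussian_law_mean:
  assumes "\<sigma> > 0" "p \<in> {..<M} \<times> {..<M}"
  shows "integrable (gaussian_law M \<sigma>) (\<lambda>\<omega>. \<omega> p)" "(\<integral>\<omega>. \<omega> p \<partial>gaussian_law M \<sigma>) = 0"
proof -
  show "integrable (gaussian_law M \<sigma>) (\<lambda>\<omega>. \<omega> p)"
    using gaussian_law_monomial_integrable[OF assms assms(2), of 1 0] by simp
  let ?e = "\<lambda>r. if r = p then Suc 0 else 0"
  have "(\<integral>\<omega>. \<omega> p \<partial>gaussian_law M \<sigma>) = (\<integral>\<omega>. (\<Prod>r\<in>{..<M} \<times> {..<M}. \<omega> r ^ ?e r) \<partial>gaussian_law M \<sigma>)"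
    using assms by (simp add: prod_power_indicator)
  also have "\<dots> = (\<Prod>r\<in>{..<M} \<times> {..<M}. \<integral>x. x ^ ?e r \<partial>normal_law \<sigma>)"
    by (rule gaussian_law_product(2)[OF assms(1)]) (rule normal_law_power(1)[OF assms(1)])
  also have "\<dots> = 0"
    using assms(2) normal_law_moments(2)[OF assms(1)] by (intro prod_zero bexI[of _ p]) simp_all
  finally show "(\<integral>\<omega>. \<omega> p \<partial>gaussian_law M \<sigma>) = 0" .
qed

lemma gaussian_law_covariance:
  assumes "\<sigma> > 0" "p \<in> {..<M} \<times> {..<M}" "q \<in> {..<M} \<times> {..<M}"
  shows "integrable (gaussian_law M \<sigma>) (\<lambda>\<omega>. \<omega> p * \<omega> q)"
    "(\<integral>\<omega>. \<omega> p * \<omega> q \<partial>gaussian_law M \<sigma>) = (if p = q then \<sigma>\<^sup>2 else 0)"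
proof -
  show "integrable (gaussian_law M \<sigma>) (\<lambda>\<omega>. \<omega> p * \<omega> q)"
    using gaussian_law_monomial_integrable[OF assms, of 1 1] by simp
  \<comment> \<open>This exponent vector represents the product for distinct as well as for equal entries.\<close>
  let ?e = "\<lambda>r. (if r = p then Suc 0 else 0) + (if r = q then Suc 0 else 0)"
  have "(\<Prod>r\<in>{..<M} \<times> {..<M}. \<omega> r ^ ?e r) = \<omega> p * \<omega> q" for \<omega> :: "nat \<times> nat \<Rightarrow> real"
    unfolding power_add prod.distrib using assms(2,3) by (simp add: prod_power_indicator)
  then have "(\<integral>\<omega>. \<omega> p * \<omega> q \<partial>gaussian_law M \<sigma>)
      = (\<integral>\<omega>. (\<Prod>r\<in>{..<M} \<times> {..<M}. \<omega> r ^ ?e r) \<partial>gaussian_law M \<sigma>)" by simp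
  also have "\<dots> = (\<Prod>r\<in>{..<M} \<times> {..<M}. \<integral>x. x ^ ?e r \<partial>normal_law \<sigma>)"
    by (rule gaussian_law_product(2)[OF assms(1)]) (rule normal_law_power(1)[OF assms(1)])
  also have "\<dots> = (if p = q then \<sigma>\<^sup>2 else 0)"
  proof (cases "p = q")
    case True
    have "(\<Prod>r\<in>{..<M} \<times> {..<M}. \<integral>x. x ^ ?e r \<partial>normal_law \<sigma>)
        = (\<Prod>r\<in>{..<M} \<times> {..<M}. if r = p then \<sigma>\<^sup>2 else 1)"
      using True normal_law_moments[OF assms(1)]
      by (intro prod.cong refl) (simp add: numeral_2_eq_2)
    then show ?thesis using True assms(2) by (simp add: prod.delta)
  next
    case False
    have "(\<integral>x. x ^ ?e p \<partial>normal_law \<sigma>) = 0"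
      using False normal_law_moments(2)[OF assms(1)] by simp
    then have "(\<Prod>r\<in>{..<M} \<times> {..<M}. \<integral>x. x ^ ?e r \<partial>normal_law \<sigma>) = 0"
      using assms(2) by (intro prod_zero finite_cartesian_product finite_lessThan bexI[of _ p])
    then show ?thesis using False by simp
  qed
  finally show "(\<integral>\<omega>. \<omega> p * \<omega> q \<partial>gaussian_law M \<sigma>) = (if p = q then \<sigma>\<^sup>2 else 0)" .
qed

lemma gaussian_law_linear_sq:
  assumes "\<sigma> > 0"
  shows "has_bochner_integral (gaussian_law M \<sigma>) (\<lambda>\<omega>. (\<Sum>p\<in>{..<M} \<times> {..<M}. c p * \<omega> p)\<^sup>2)
    (\<sigma>\<^sup>2 * (\<Sum>p\<in>{..<M} \<times> {..<M}. (c p)\<^sup>2))"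
proof -
  let ?I = "{..<M} \<times> {..<M}"
  have e: "(\<Sum>p\<in>?I. c p * \<omega> p)\<^sup>2 = (\<Sum>p\<in>?I. \<Sum>q\<in>?I. c p * c q * (\<omega> p * \<omega> q))" for \<omega>
    unfolding power2_eq_square sum_product by (simp add: mult_ac)
  have cov: "has_bochner_integral (gaussian_law M \<sigma>) (\<lambda>\<omega>. \<omega> p * \<omega> q) (if p = q then \<sigma>\<^sup>2 else 0)"
    if "p \<in> ?I" "q \<in> ?I" for p q
    using gaussian_law_covariance[OF assms that] by (simp add: has_bochner_integral_iff)
  have "has_bochner_integral (gaussian_law M \<sigma>) (\<lambda>\<omega>. (\<Sum>p\<in>?I. c p * \<omega> p)\<^sup>2)
      (\<Sum>p\<in>?I. \<Sum>q\<in>?I. c p * c q * (if p = q then \<sigma>\<^sup>2 else 0))"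
    unfolding e by (intro has_bochner_integral_sum has_bochner_integral_mult_right cov)
  also have "(\<Sum>p\<in>?I. \<Sum>q\<in>?I. c p * c q * (if p = q then \<sigma>\<^sup>2 else 0))
      = (\<Sum>p\<in>?I. \<Sum>q\<in>?I. if p = q then \<sigma>\<^sup>2 * (c p)\<^sup>2 else 0)"
    by (intro sum.cong refl) (simp add: power2_eq_square)
  also have "\<dots> = (\<Sum>p\<in>?I. \<sigma>\<^sup>2 * (c p)\<^sup>2)"
    by (intro sum.cong refl, subst sum.delta') simp_all
  also have "\<dots> = \<sigma>\<^sup>2 * (\<Sum>p\<in>?I. (c p)\<^sup>2)"
    by (simp only: sum_distrib_left)
  finally show ?thesis .
qed

abbreviation noise :: "nat \<Rightarrow> (nat \<times> nat \<Rightarrow> real) \<Rightarrow> real mat" where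
  "noise M \<omega> \<equiv> Matrix.mat M M \<omega>"

lemma noise_linear:
  assumes A: "A \<in> carrier_mat M M" and "\<sigma> > 0"
  shows "has_bochner_integral (gaussian_law M \<sigma>) (\<lambda>\<omega>. hs_inner A (noise M \<omega>)) 0"
proof -
  have e: "hs_inner A (noise M \<omega>) = (\<Sum>p\<in>{..<M} \<times> {..<M}. A $$ p * \<omega> p)" for \<omega>
    unfolding hs_inner_eq_sum[OF A] by (intro sum.cong refl) auto
  have m: "has_bochner_integral (gaussian_law M \<sigma>) (\<lambda>\<omega>. \<omega> p) 0" if "p \<in> {..<M} \<times> {..<M}" for p
    using gaussian_law_mean[OF assms(2) that] by (simp add: has_bochner_integral_iff)
  have "has_bochner_integral (gaussian_law M \<sigma>) (\<lambda>\<omega>. hs_inner A (noise M \<omega>))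
    (\<Sum>p\<in>{..<M} \<times> {..<M}. A $$ p * 0)"
    unfolding e by (intro has_bochner_integral_sum has_bochner_integral_mult_right m)
  then show ?thesis by simp
qed

lemma noise_energy:
  assumes A: "A \<in> carrier_mat M M" and B: "B \<in> carrier_mat M M" and "\<sigma> > 0"
  shows "has_bochner_integral (gaussian_law M \<sigma>)
    (\<lambda>\<omega>. hs_inner (A * noise M \<omega> * B) (A * noise M \<omega> * B))
    (\<sigma>\<^sup>2 * hs_inner A A * hs_inner B B)"
proof -
  let ?I = "{..<M} \<times> {..<M}"
  define c where "c = (\<lambda>i j p. A $$ (i, fst p) * B $$ (snd p, j))"
  have N: "noise M \<omega> \<in> carrier_mat M M" for \<omega> by simp
  have AN: "(A * noise M \<omega>) $$ (i, k) = (\<Sum>l<M. A $$ (i, l) * \<omega> (l, k))" if "i < M" "k < M" for i k \<omega>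
    unfolding mat_mult_index[OF A N that] using that by (intro sum.cong refl) simp
  have ANc: "A * noise M \<omega> \<in> carrier_mat M M" for \<omega> using A by simp
  have ent: "(A * noise M \<omega> * B) $$ (i, j) = (\<Sum>p\<in>?I. c i j p * \<omega> p)" if "i < M" "j < M" for i j \<omega>
  proof -
    have "(A * noise M \<omega> * B) $$ (i, j) = (\<Sum>k<M. (\<Sum>l<M. A $$ (i, l) * \<omega> (l, k)) * B $$ (k, j))"
      unfolding mat_mult_index[OF ANc B that] using that(1) AN by (intro sum.cong refl) simp
    also have "\<dots> = (\<Sum>l<M. \<Sum>k<M. A $$ (i, l) * \<omega> (l, k) * B $$ (k, j))"
      unfolding sum_distrib_right by (rule sum.swap)
    also have "\<dots> = (\<Sum>p\<in>?I. c i j p * \<omega> p)"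
      unfolding sum.cartesian_product c_def by (intro sum.cong refl) (auto simp: mult_ac)
    finally show ?thesis .
  qed
  have dims: "dim_row (A * noise M \<omega> * B) = M" "dim_col (A * noise M \<omega> * B) = M" for \<omega>
    using A B by simp_all
  have e: "hs_inner (A * noise M \<omega> * B) (A * noise M \<omega> * B)
      = (\<Sum>i<M. \<Sum>j<M. (\<Sum>p\<in>?I. c i j p * \<omega> p)\<^sup>2)" for \<omega>
    unfolding hs_inner_def dims power2_eq_square
    by (intro sum.cong refl arg_cong2[of _ _ _ _ "(*)"] ent) simp_all
  have "has_bochner_integral (gaussian_law M \<sigma>)
    (\<lambda>\<omega>. hs_inner (A * noise M \<omega> * B) (A * noise M \<omega> * B))
    (\<Sum>i<M. \<Sum>j<M. \<sigma>\<^sup>2 * (\<Sum>p\<in>?I. (c i j p)\<^sup>2))"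
    unfolding e by (intro has_bochner_integral_sum gaussian_law_linear_sq[OF assms(3)])
  also have "(\<Sum>i<M. \<Sum>j<M. \<sigma>\<^sup>2 * (\<Sum>p\<in>?I. (c i j p)\<^sup>2))
      = \<sigma>\<^sup>2 * (\<Sum>i<M. \<Sum>j<M. \<Sum>l<M. \<Sum>k<M. (A $$ (i, l))\<^sup>2 * (B $$ (k, j))\<^sup>2)"
    unfolding sum_distrib_left c_def
    by (simp add: sum.cartesian_product case_prod_beta power_mult_distrib)
  also have "(\<Sum>i<M. \<Sum>j<M. \<Sum>l<M. \<Sum>k<M. (A $$ (i, l))\<^sup>2 * (B $$ (k, j))\<^sup>2)
      = (\<Sum>i<M. \<Sum>l<M. (A $$ (i, l))\<^sup>2) * (\<Sum>j<M. \<Sum>k<M. (B $$ (k, j))\<^sup>2)"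
    by (simp add: sum_product)
  also have "(\<Sum>j<M. \<Sum>k<M. (B $$ (k, j))\<^sup>2) = (\<Sum>k<M. \<Sum>j<M. (B $$ (k, j))\<^sup>2)" by (rule sum.swap)
  also have "\<sigma>\<^sup>2 * ((\<Sum>i<M. \<Sum>l<M. (A $$ (i, l))\<^sup>2) * (\<Sum>k<M. \<Sum>j<M. (B $$ (k, j))\<^sup>2))
      = \<sigma>\<^sup>2 * hs_inner A A * hs_inner B B"
    unfolding hs_inner_def using A B by (simp add: power2_eq_square)
  finally show ?thesis .
qed

lemma noise_energy_integrable:
  assumes "\<sigma> > 0"
  shows "integrable (gaussian_law M \<sigma>) (\<lambda>\<omega>. hs_inner (noise M \<omega>) (noise M \<omega>))"
    and "integrable (gaussian_law M \<sigma>) (\<lambda>\<omega>. (hs_inner (noise M \<omega>) (noise M \<omega>))\<^sup>2)"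
proof -
  let ?I = "{..<M} \<times> {..<M}"
  have e: "hs_inner (noise M \<omega>) (noise M \<omega>) = (\<Sum>p\<in>?I. \<omega> p * \<omega> p)" for \<omega>
    by (subst hs_inner_eq_sum[of _ M M]) (auto intro!: sum.cong)
  show "integrable (gaussian_law M \<sigma>) (\<lambda>\<omega>. hs_inner (noise M \<omega>) (noise M \<omega>))"
    unfolding e by (intro Bochner_Integration.integrable_sum gaussian_law_covariance(1)[OF assms])
  have s: "(\<Sum>p\<in>?I. \<omega> p * \<omega> p)\<^sup>2 = (\<Sum>p\<in>?I. \<Sum>q\<in>?I. \<omega> p ^ 2 * \<omega> q ^ 2)" for \<omega> :: "nat \<times> nat \<Rightarrow> real"
    unfolding power2_eq_square[of "sum _ _"] sum_product by (simp add: power2_eq_square)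
  show "integrable (gaussian_law M \<sigma>) (\<lambda>\<omega>. (hs_inner (noise M \<omega>) (noise M \<omega>))\<^sup>2)"
    unfolding e s
    by (intro Bochner_Integration.integrable_sum gaussian_law_monomial_integrable[OF assms])
qed

section \<open>The operator norm of Gaussian noise\<close>

text \<open>
  A discrete substitute for the ball of radius \<open>2\<close>, scaled by \<open>sqrt M\<close>. The box makes
  finiteness evident, and sums over a box factorise over the coordinates.
\<close>
definition int_grid :: "nat \<Rightarrow> (nat \<Rightarrow> int) set" where
  "int_grid M = {z \<in> PiE {..<M} (\<lambda>_. {- int (4 * M)..int (4 * M)}). (\<Sum>i<M. (z i)\<^sup>2) \<le> int (4 * M)}"

lemma finite_int_grid: "finite (int_grid M)"
  by (rule finite_subset[of _ "PiE {..<M} (\<lambda>_. {- int (4 * M)..int (4 * M)})"])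
     (auto simp: int_grid_def intro: finite_PiE)

lemma int_grid_norm: "z \<in> int_grid M \<Longrightarrow> (\<Sum>i<M. (real_of_int (z i))\<^sup>2) \<le> 4 * real M"
proof -
  assume "z \<in> int_grid M"
  then have "real_of_int (\<Sum>i<M. (z i)\<^sup>2) \<le> real_of_int (int (4 * M))"
    unfolding int_grid_def of_int_le_iff by simp
  then show ?thesis by simp
qed

lemma sum_geometric_two_sided:
  "(\<Sum>k\<in>{- int K..int K}. (1 / 2) ^ nat \<bar>k\<bar>) = 3 - 2 * (1 / 2 :: real) ^ K"
proof (induction K)
  case (Suc K)
  have "{- int (Suc K)..int (Suc K)} = insert (- int (Suc K)) (insert (int (Suc K)) {- int K..int K})"
    by auto
  then show ?case using Suc by (simp add: nat_add_distrib)
qed simp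

text \<open>
  On the grid \<open>1 \<le> exp (4 * M - \<bar>z\<bar>\<^sup>2)\<close>. Summing this over the whole box factorises into
  \<open>exp (4 * M)\<close> times the \<open>M\<close>-th power of a sum over \<open>k\<close> of \<open>exp (- k\<^sup>2)\<close>, which is at most
  \<open>3 \<le> exp 2\<close>.
\<close>
lemma card_int_grid: "real (card (int_grid M)) \<le> exp (6 * real M)"
proof -
  let ?K = "{- int (4 * M)..int (4 * M)}"
  let ?F = "PiE {..<M} (\<lambda>_. ?K)"
  have e3: "(3::real) \<le> exp 2" using exp_ge_add_one_self[of 2] by simp
  have term_le: "exp (- (real_of_int k)\<^sup>2) \<le> (1 / 2) ^ nat \<bar>k\<bar>" for k :: int
  proof -
    have "\<bar>real_of_int k\<bar> \<le> (real_of_int k)\<^sup>2"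
    proof (cases "k = 0")
      case False
      then have "1 \<le> \<bar>real_of_int k\<bar>" by linarith
      then have "\<bar>real_of_int k\<bar> * 1 \<le> \<bar>real_of_int k\<bar> * \<bar>real_of_int k\<bar>" by (intro mult_left_mono) auto
      then show ?thesis by (simp add: power2_eq_square)
    qed simp
    then have "exp (- (real_of_int k)\<^sup>2) \<le> exp (- \<bar>real_of_int k\<bar>)" by simp
    also have "\<dots> = exp (real (nat \<bar>k\<bar>) * (-1))" by simp
    also have "\<dots> = exp (-1) ^ nat \<bar>k\<bar>" by (rule exp_of_nat_mult)
    also have "\<dots> \<le> (1 / 2) ^ nat \<bar>k\<bar>"
    proof (rule power_mono)
      have "inverse (exp 1) \<le> inverse (2::real)"
        using exp_ge_add_one_self[of 1] by (intro le_imp_inverse_le) simp_all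
      then show "exp (- 1) \<le> (1 / 2 :: real)" by (simp add: exp_minus inverse_eq_divide)
    qed simp
    finally show ?thesis .
  qed
  have "(\<Sum>k\<in>?K. exp (- (real_of_int k)\<^sup>2)) \<le> (\<Sum>k\<in>?K. (1 / 2) ^ nat \<bar>k\<bar>)"
    by (intro sum_mono term_le)
  also have "\<dots> \<le> 3" unfolding sum_geometric_two_sided by simp
  finally have S: "(\<Sum>k\<in>?K. exp (- (real_of_int k)\<^sup>2)) \<le> 3" .
  have "real (card (int_grid M)) = (\<Sum>z\<in>int_grid M. 1)" by simp
  also have "\<dots> \<le> (\<Sum>z\<in>int_grid M. exp (4 * real M) * (\<Prod>i<M. exp (- (real_of_int (z i))\<^sup>2)))"
  proof (rule sum_mono)
    fix z assume "z \<in> int_grid M"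
    from int_grid_norm[OF this] have "0 \<le> 4 * real M - (\<Sum>i<M. (real_of_int (z i))\<^sup>2)" by linarith
    then have "1 \<le> exp (4 * real M - (\<Sum>i<M. (real_of_int (z i))\<^sup>2))" by simp
    also have "\<dots> = exp (4 * real M) * exp (\<Sum>i<M. - (real_of_int (z i))\<^sup>2)"
      unfolding sum_negf exp_add[symmetric] by simp
    also have "exp (\<Sum>i<M. - (real_of_int (z i))\<^sup>2) = (\<Prod>i<M. exp (- (real_of_int (z i))\<^sup>2))"
      by (rule exp_sum) simp
    finally show "1 \<le> exp (4 * real M) * (\<Prod>i<M. exp (- (real_of_int (z i))\<^sup>2))" .
  qed
  also have "\<dots> \<le> (\<Sum>z\<in>?F. exp (4 * real M) * (\<Prod>i<M. exp (- (real_of_int (z i))\<^sup>2)))"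
  proof (rule sum_mono2)
    show "finite ?F" by (intro finite_PiE) simp_all
    show "int_grid M \<subseteq> ?F" unfolding int_grid_def by blast
  qed (intro mult_nonneg_nonneg prod_nonneg; simp)
  also have "\<dots> = exp (4 * real M) * (\<Sum>z\<in>?F. \<Prod>i<M. exp (- (real_of_int (z i))\<^sup>2))"
    by (rule sum_distrib_left[symmetric])
  also have "(\<Sum>z\<in>?F. \<Prod>i<M. exp (- (real_of_int (z i))\<^sup>2)) = (\<Prod>i<M. \<Sum>k\<in>?K. exp (- (real_of_int k)\<^sup>2))"
    by (rule prod_sum_PiE[symmetric]) simp_all
  also have "\<dots> = (\<Sum>k\<in>?K. exp (- (real_of_int k)\<^sup>2)) ^ M" by simp
  also have "exp (4 * real M) * \<dots> \<le> exp (4 * real M) * (exp 2) ^ M"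
    using S e3 by (intro mult_left_mono power_mono sum_nonneg) simp_all
  also have "(exp 2) ^ M = exp (real M * 2)" by (rule exp_of_nat_mult[symmetric])
  also have "exp (4 * real M) * exp (real M * 2) = exp (6 * real M)" unfolding exp_add[symmetric] by simp
  finally show ?thesis .
qed

text \<open>
  Rounding each coordinate of \<open>sqrt M * v\<close> up or down according to the sign of its coefficient
  can only increase the value of the linear functional.
  Each coordinate moves by at most \<open>1\<close>, so the squared norm stays below \<open>2 * M + 2 * M\<close>.
\<close>
lemma rounding_to_int_grid:
  fixes a v :: "nat \<Rightarrow> real"
  assumes M: "M \<ge> 1" and v: "(\<Sum>i<M. (v i)\<^sup>2) \<le> 1"
  obtains z where "z \<in> int_grid M" "sqrt (real M) * (\<Sum>i<M. a i * v i) \<le> (\<Sum>i<M. a i * real_of_int (z i))"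
proof -
  define y where "y i = sqrt (real M) * v i" for i
  define z where "z = (\<lambda>i\<in>{..<M}. if a i \<ge> 0 then \<lceil>y i\<rceil> else \<lfloor>y i\<rfloor>)"
  have z_near: "\<bar>real_of_int (z i) - y i\<bar> \<le> 1" and z_better: "a i * y i \<le> a i * real_of_int (z i)"
    if "i < M" for i
    using that unfolding z_def
    by (simp_all add: mult_left_mono mult_left_mono_neg) linarith+
  have z_sq: "(real_of_int (z i))\<^sup>2 \<le> 2 * (y i)\<^sup>2 + 2" if "i < M" for i
  proof -
    define d where "d = real_of_int (z i) - y i"
    have "d\<^sup>2 \<le> 1" using z_near[OF that] abs_square_le_1 unfolding d_def by blast
    moreover have "(real_of_int (z i))\<^sup>2 = 2 * (y i)\<^sup>2 + 2 * d\<^sup>2 - (y i - d)\<^sup>2"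
      unfolding d_def by (simp add: power2_eq_square algebra_simps)
    ultimately show ?thesis using zero_le_power2[of "y i - d"] by linarith
  qed
  have "(\<Sum>i<M. (real_of_int (z i))\<^sup>2) \<le> (\<Sum>i<M. 2 * (y i)\<^sup>2 + 2)"
    by (intro sum_mono z_sq) simp
  also have "\<dots> = 2 * (real M * (\<Sum>i<M. (v i)\<^sup>2)) + 2 * real M"
    unfolding y_def by (simp add: sum.distrib power_mult_distrib sum_distrib_left)
  also have "\<dots> \<le> 2 * (real M * 1) + 2 * real M"
    using v by (intro add_right_mono mult_left_mono) auto
  finally have "real_of_int (\<Sum>i<M. (z i)\<^sup>2) \<le> real_of_int (int (4 * M))" by simp
  then have sq: "(\<Sum>i<M. (z i)\<^sup>2) \<le> int (4 * M)" by (simp only: of_int_le_iff)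
  have "z i \<in> {- int (4 * M)..int (4 * M)}" if "i < M" for i
  proof -
    have "\<bar>z i\<bar> \<le> (z i)\<^sup>2"
    proof (cases "z i = 0")
      case False
      then have "\<bar>z i\<bar> * 1 \<le> \<bar>z i\<bar> * \<bar>z i\<bar>" by (intro mult_left_mono) auto
      then show ?thesis by (simp add: power2_eq_square)
    qed simp
    also have "\<dots> \<le> (\<Sum>i<M. (z i)\<^sup>2)" using that by (intro member_le_sum) auto
    finally show ?thesis using sq by auto
  qed
  then have "z \<in> int_grid M" unfolding int_grid_def using sq by (auto simp: z_def)
  moreover have "sqrt (real M) * (\<Sum>i<M. a i * v i) = (\<Sum>i<M. a i * y i)"
    unfolding y_def by (simp add: sum_distrib_left mult_ac)
  then have "sqrt (real M) * (\<Sum>i<M. a i * v i) \<le> (\<Sum>i<M. a i * real_of_int (z i))"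
    using sum_mono[of "{..<M}", OF z_better] by simp
  ultimately show ?thesis by (rule that)
qed

definition bilin :: "nat \<Rightarrow> (nat \<times> nat \<Rightarrow> real) \<Rightarrow> (nat \<Rightarrow> real) \<Rightarrow> (nat \<Rightarrow> real) \<Rightarrow> real" where
  "bilin M \<omega> u v = (\<Sum>i<M. \<Sum>j<M. u i * \<omega> (i, j) * v j)"

lemma bilin_left: "bilin M \<omega> u v = (\<Sum>i<M. (\<Sum>j<M. \<omega> (i, j) * v j) * u i)"
  unfolding bilin_def by (simp add: sum_distrib_left sum_distrib_right mult_ac)

lemma bilin_right: "bilin M \<omega> u v = (\<Sum>j<M. (\<Sum>i<M. u i * \<omega> (i, j)) * v j)"
  unfolding bilin_def sum_distrib_right by (rule sum.swap)

lemma bilin_uminus_left: "bilin M \<omega> (\<lambda>i. - u i) v = - bilin M \<omega> u v"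
  unfolding bilin_def by (simp add: sum_negf)

lemma bilin_scale: "bilin M \<omega> (\<lambda>i. a * u i) (\<lambda>i. b * v i) = a * b * bilin M \<omega> u v"
  unfolding bilin_def by (simp add: sum_distrib_left mult_ac)

text \<open>
  The sum of exponentials dominates the exponential of the maximum over the grid, while its
  expectation is explicit. The temperature \<open>\<sigma> * sqrt M\<close> makes every exponent of size \<open>M\<close>, the
  order of the entropy of the grid.
\<close>
definition grid_partition :: "nat \<Rightarrow> real \<Rightarrow> (nat \<times> nat \<Rightarrow> real) \<Rightarrow> real" where
  "grid_partition M \<sigma> \<omega> = (\<Sum>z\<in>int_grid M. \<Sum>z'\<in>int_grid M.
     exp (bilin M \<omega> (\<lambda>i. real_of_int (z i)) (\<lambda>j. real_of_int (z' j)) / (\<sigma> * sqrt (real M))))"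

text \<open>
  Each exponent is a centred Gaussian variable, and the bounds on the norms of the grid points limit
  its variance to \<open>16 * M\<close>. Each of the at most \<open>exp (12 * M)\<close> pairs thus contributes at most
  \<open>exp (8 * M)\<close>.
\<close>
lemma grid_partition_expectation:
  assumes s: "\<sigma> > 0" and M: "M \<ge> 1"
  shows "integrable (gaussian_law M \<sigma>) (grid_partition M \<sigma>)"
    and "(\<integral>\<omega>. grid_partition M \<sigma> \<omega> \<partial>gaussian_law M \<sigma>) \<le> exp (20 * real M)"
proof -
  let ?I = "{..<M} \<times> {..<M}" and ?G = "int_grid M"
  define c where "c z z' p = real_of_int (z (fst p)) * real_of_int (z' (snd p)) / (\<sigma> * sqrt (real M))"
    for z z' :: "nat \<Rightarrow> int" and p
  have e: "bilin M \<omega> (\<lambda>i. real_of_int (z i)) (\<lambda>j. real_of_int (z' j)) / (\<sigma> * sqrt (real M))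
      = (\<Sum>p\<in>?I. c z z' p * \<omega> p)" for z z' \<omega>
    unfolding bilin_def c_def sum.cartesian_product sum_divide_distrib
    by (intro sum.cong refl) (auto simp: mult_ac)
  have h: "has_bochner_integral (gaussian_law M \<sigma>) (\<lambda>\<omega>. exp (\<Sum>p\<in>?I. c z z' p * \<omega> p))
      (exp (\<sigma>\<^sup>2 / 2 * (\<Sum>p\<in>?I. (c z z' p)\<^sup>2)))" for z z'
    using gaussian_law_exp_linear[OF s, of M "c z z'"] by (simp add: has_bochner_integral_iff)
  have H: "has_bochner_integral (gaussian_law M \<sigma>) (\<lambda>\<omega>. grid_partition M \<sigma> \<omega>)
      (\<Sum>z\<in>?G. \<Sum>z'\<in>?G. exp (\<sigma>\<^sup>2 / 2 * (\<Sum>p\<in>?I. (c z z' p)\<^sup>2)))"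
    unfolding grid_partition_def e by (intro has_bochner_integral_sum h)
  then show "integrable (gaussian_law M \<sigma>) (grid_partition M \<sigma>)"
    by (auto simp: has_bochner_integral_iff)
  have le: "\<sigma>\<^sup>2 / 2 * (\<Sum>p\<in>?I. (c z z' p)\<^sup>2) \<le> 8 * real M" if "z \<in> ?G" "z' \<in> ?G" for z z'
  proof -
    have "(\<Sum>p\<in>?I. (c z z' p)\<^sup>2)
        = (\<Sum>i<M. (real_of_int (z i))\<^sup>2) * (\<Sum>j<M. (real_of_int (z' j))\<^sup>2) / (\<sigma>\<^sup>2 * real M)"
      unfolding c_def sum_product sum.cartesian_product sum_divide_distrib
      by (intro sum.cong refl) (auto simp: power_mult_distrib power_divide)
    also have "\<dots> \<le> (4 * real M) * (4 * real M) / (\<sigma>\<^sup>2 * real M)"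
      using that by (intro divide_right_mono mult_mono int_grid_norm) (auto intro!: sum_nonneg)
    also have "\<dots> = 16 * real M / \<sigma>\<^sup>2" using M by (simp add: field_simps)
    finally have "\<sigma>\<^sup>2 / 2 * (\<Sum>p\<in>?I. (c z z' p)\<^sup>2) \<le> \<sigma>\<^sup>2 / 2 * (16 * real M / \<sigma>\<^sup>2)"
      by (intro mult_left_mono) auto
    then show ?thesis using s by simp
  qed
  have "(\<integral>\<omega>. grid_partition M \<sigma> \<omega> \<partial>gaussian_law M \<sigma>)
      = (\<Sum>z\<in>?G. \<Sum>z'\<in>?G. exp (\<sigma>\<^sup>2 / 2 * (\<Sum>p\<in>?I. (c z z' p)\<^sup>2)))"
    using H by (rule has_bochner_integral_integral_eq)
  also have "\<dots> \<le> (\<Sum>z\<in>?G. \<Sum>z'\<in>?G. exp (8 * real M))"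
    by (intro sum_mono iffD2[OF exp_le_cancel_iff] le)
  also have "\<dots> = real (card ?G) * real (card ?G) * exp (8 * real M)" by simp
  also have "\<dots> \<le> exp (6 * real M) * exp (6 * real M) * exp (8 * real M)"
    by (intro mult_right_mono mult_mono card_int_grid) auto
  also have "\<dots> = exp (20 * real M)" unfolding exp_add[symmetric] by simp
  finally show "(\<integral>\<omega>. grid_partition M \<sigma> \<omega> \<partial>gaussian_law M \<sigma>) \<le> exp (20 * real M)" .
qed

text \<open>
  With \<open>v\<close> held fixed the bilinear form is linear in \<open>u\<close>, which may thus be rounded; then \<open>v\<close>
  is rounded with the rounded \<open>u\<close> held fixed.
\<close>
lemma exp_bilin_le_grid_partition:
  assumes s: "\<sigma> > 0" and M: "M \<ge> 1"
    and u: "(\<Sum>i<M. (u i)\<^sup>2) \<le> 1" and v: "(\<Sum>i<M. (v i)\<^sup>2) \<le> 1"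
  shows "exp (sqrt (real M) / \<sigma> * bilin M \<omega> u v) \<le> grid_partition M \<sigma> \<omega>"
proof -
  obtain z where z: "z \<in> int_grid M"
    "sqrt (real M) * (\<Sum>i<M. (\<Sum>j<M. \<omega> (i, j) * v j) * u i)
      \<le> (\<Sum>i<M. (\<Sum>j<M. \<omega> (i, j) * v j) * real_of_int (z i))"
    by (rule rounding_to_int_grid[OF M u]) (rule that)
  obtain z' where z': "z' \<in> int_grid M"
    "sqrt (real M) * (\<Sum>j<M. (\<Sum>i<M. real_of_int (z i) * \<omega> (i, j)) * v j)
      \<le> (\<Sum>j<M. (\<Sum>i<M. real_of_int (z i) * \<omega> (i, j)) * real_of_int (z' j))"
    by (rule rounding_to_int_grid[OF M v]) (rule that)
  let ?r = "\<lambda>z i. real_of_int (z i)"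
  let ?b = "bilin M \<omega>"
  have 1: "sqrt (real M) * ?b u v \<le> ?b (?r z) v" using z(2) unfolding bilin_left .
  have 2: "sqrt (real M) * ?b (?r z) v \<le> ?b (?r z) (?r z')" using z'(2) unfolding bilin_right .
  have "real M * ?b u v = sqrt (real M) * (sqrt (real M) * ?b u v)" by simp
  also have "\<dots> \<le> sqrt (real M) * ?b (?r z) v" using 1 by (intro mult_left_mono) auto
  finally have 3: "real M * ?b u v \<le> ?b (?r z) (?r z')" using 2 by simp
  have "sqrt (real M) / \<sigma> * ?b u v = real M * ?b u v / (\<sigma> * sqrt (real M))"
    using s M by (simp add: field_simps)
  also have "\<dots> \<le> ?b (?r z) (?r z') / (\<sigma> * sqrt (real M))"
    using 3 s by (intro divide_right_mono) auto
  finally have "exp (sqrt (real M) / \<sigma> * ?b u v) \<le> exp (?b (?r z) (?r z') / (\<sigma> * sqrt (real M)))" by simp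
  also have "\<dots> \<le> (\<Sum>z'\<in>int_grid M. exp (?b (?r z) (?r z') / (\<sigma> * sqrt (real M))))"
    by (rule member_le_sum[OF z'(1)]) (auto simp: finite_int_grid)
  also have "\<dots> \<le> grid_partition M \<sigma> \<omega>"
    unfolding grid_partition_def
    by (rule member_le_sum[OF z(1)]) (auto simp: finite_int_grid intro!: sum_nonneg)
  finally show ?thesis .
qed

text \<open>
  An explicitly integrable majorant of the squared operator norm of the noise, of expectation of
  order \<open>\<sigma>\<^sup>2 * M\<close>. It is what \<open>square_le_exp_shift\<close> yields at \<open>k = 20 * M\<close>, the exponent in the
  expectation of the partition sum; hence \<open>800 = 2 * 20\<^sup>2\<close>.
\<close>
definition op_norm_sq_bound :: "nat \<Rightarrow> real \<Rightarrow> (nat \<times> nat \<Rightarrow> real) \<Rightarrow> real" where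
  "op_norm_sq_bound M \<sigma> \<omega> =
     \<sigma>\<^sup>2 / real M * (800 * (real M)\<^sup>2 + 4 * (exp (- (20 * real M)) * grid_partition M \<sigma> \<omega>))"

lemma op_norm_sq_bound_nonneg: "0 \<le> op_norm_sq_bound M \<sigma> \<omega>"
  unfolding op_norm_sq_bound_def grid_partition_def
  by (intro mult_nonneg_nonneg add_nonneg_nonneg sum_nonneg) auto

lemma op_norm_sq_bound_expectation:
  assumes s: "\<sigma> > 0" and M: "M \<ge> 1"
  shows "integrable (gaussian_law M \<sigma>) (op_norm_sq_bound M \<sigma>)"
    and "(\<integral>\<omega>. op_norm_sq_bound M \<sigma> \<omega> \<partial>gaussian_law M \<sigma>) \<le> 804 * \<sigma>\<^sup>2 * real M"
proof -
  interpret prob_space "gaussian_law M \<sigma>" by (rule prob_space_gaussian_law[OF s])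
  note g = grid_partition_expectation[OF s M]
  show "integrable (gaussian_law M \<sigma>) (op_norm_sq_bound M \<sigma>)"
    unfolding op_norm_sq_bound_def using g(1) by simp
  have "(\<integral>\<omega>. op_norm_sq_bound M \<sigma> \<omega> \<partial>gaussian_law M \<sigma>)
     = \<sigma>\<^sup>2 / real M * (800 * (real M)\<^sup>2 + 4 * (exp (- (20 * real M)) * (\<integral>\<omega>. grid_partition M \<sigma> \<omega> \<partial>gaussian_law M \<sigma>)))"
    unfolding op_norm_sq_bound_def using g(1) by (simp add: prob_space)
  also have "\<dots> \<le> \<sigma>\<^sup>2 / real M * (800 * (real M)\<^sup>2 + 4 * (exp (- (20 * real M)) * exp (20 * real M)))"
    using g(2) by (intro mult_left_mono add_left_mono) auto
  also have "\<dots> = \<sigma>\<^sup>2 / real M * (800 * (real M)\<^sup>2 + 4)" by (simp add: exp_minus)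
  also have "\<dots> \<le> \<sigma>\<^sup>2 / real M * (800 * (real M)\<^sup>2 + 4 * (real M)\<^sup>2)"
    using M by (intro mult_left_mono add_left_mono) auto
  also have "\<dots> = 804 * \<sigma>\<^sup>2 * real M" using M by (simp add: power2_eq_square)
  finally show "(\<integral>\<omega>. op_norm_sq_bound M \<sigma> \<omega> \<partial>gaussian_law M \<sigma>) \<le> 804 * \<sigma>\<^sup>2 * real M" .
qed

text \<open>
  Turns an exponential moment into a second moment without a loss beyond the shift \<open>k\<close>.
\<close>
lemma square_le_exp_shift:
  fixes y k :: real
  assumes "y \<ge> 0" "k \<ge> 0"
  shows "y\<^sup>2 \<le> 2 * k\<^sup>2 + 4 * exp (y - k)"
proof (cases "y \<le> k")
  case True
  then have "y\<^sup>2 \<le> k\<^sup>2" using assms by (intro power_mono) auto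
  then show ?thesis using zero_le_power2[of k] exp_gt_zero[of "y - k"] by linarith
next
  case False
  define w where "w = y - k"
  have "1 + w + w\<^sup>2 / 2 \<le> exp w" using False by (intro exp_lower_Taylor_quadratic) (auto simp: w_def)
  then have "w\<^sup>2 \<le> 2 * exp w" using False by (simp add: w_def)
  moreover have "y\<^sup>2 = 2 * k\<^sup>2 + 2 * w\<^sup>2 - (k - w)\<^sup>2" unfolding w_def by (simp add: power2_eq_square algebra_simps)
  ultimately show ?thesis using zero_le_power2[of "k - w"] unfolding w_def by linarith
qed

lemma bilin_unit_le:
  assumes s: "\<sigma> > 0" and M: "M \<ge> 1"
    and u: "(\<Sum>i<M. (u i)\<^sup>2) \<le> 1" and v: "(\<Sum>i<M. (v i)\<^sup>2) \<le> 1"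
  shows "(bilin M \<omega> u v)\<^sup>2 \<le> op_norm_sq_bound M \<sigma> \<omega>"
proof -
  define y where "y = sqrt (real M) / \<sigma> * \<bar>bilin M \<omega> u v\<bar>"
  have "exp y \<le> grid_partition M \<sigma> \<omega>"
  proof (cases "bilin M \<omega> u v \<ge> 0")
    case True
    then show ?thesis using exp_bilin_le_grid_partition[OF s M u v, of \<omega>] by (simp add: y_def)
  next
    case False
    have "(\<Sum>i<M. (- u i)\<^sup>2) \<le> 1" using u by simp
    from exp_bilin_le_grid_partition[OF s M this v, of \<omega>]
    show ?thesis using False by (simp add: y_def bilin_uminus_left)
  qed
  then have "exp (y - 20 * real M) \<le> exp (- (20 * real M)) * grid_partition M \<sigma> \<omega>"
    by (simp add: exp_diff exp_minus field_simps)
  moreover have "y\<^sup>2 \<le> 2 * (20 * real M)\<^sup>2 + 4 * exp (y - 20 * real M)"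
    using s by (intro square_le_exp_shift) (auto simp: y_def)
  ultimately have "y\<^sup>2 \<le> 800 * (real M)\<^sup>2 + 4 * (exp (- (20 * real M)) * grid_partition M \<sigma> \<omega>)"
    by (simp add: power_mult_distrib)
  then have "\<sigma>\<^sup>2 / real M * y\<^sup>2 \<le> op_norm_sq_bound M \<sigma> \<omega>"
    unfolding op_norm_sq_bound_def by (intro mult_left_mono) auto
  moreover have "\<sigma>\<^sup>2 / real M * y\<^sup>2 = (bilin M \<omega> u v)\<^sup>2"
    using s M unfolding y_def by (simp add: power_mult_distrib power_divide)
  ultimately show ?thesis by simp
qed

lemma bilin_le:
  assumes s: "\<sigma> > 0" and M: "M \<ge> 1"
  shows "(bilin M \<omega> u v)\<^sup>2 \<le> op_norm_sq_bound M \<sigma> \<omega> * (\<Sum>i<M. (u i)\<^sup>2) * (\<Sum>i<M. (v i)\<^sup>2)"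
proof -
  let ?U = "\<Sum>i<M. (u i)\<^sup>2" and ?V = "\<Sum>i<M. (v i)\<^sup>2"
  have nn: "0 \<le> ?U" "0 \<le> ?V" by (auto intro: sum_nonneg)
  show ?thesis
  proof (cases "?U = 0 \<or> ?V = 0")
    case True
    then have "(\<forall>i<M. u i = 0) \<or> (\<forall>i<M. v i = 0)" by (auto simp: sum_nonneg_eq_0_iff)
    then have "bilin M \<omega> u v = 0" unfolding bilin_def by (auto intro!: sum.neutral)
    then show ?thesis using True by auto
  next
    case False
    then have pos: "?U > 0" "?V > 0" using nn by linarith+
    define a b where "a = 1 / sqrt ?U" and "b = 1 / sqrt ?V"
    have "(\<Sum>i<M. (a * u i)\<^sup>2) = a\<^sup>2 * ?U" "(\<Sum>i<M. (b * v i)\<^sup>2) = b\<^sup>2 * ?V"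
      by (simp_all add: power_mult_distrib sum_distrib_left)
    moreover have ab: "a\<^sup>2 * ?U = 1" "b\<^sup>2 * ?V = 1"
      using pos by (simp_all add: a_def b_def power_divide)
    ultimately have "(bilin M \<omega> (\<lambda>i. a * u i) (\<lambda>i. b * v i))\<^sup>2 \<le> op_norm_sq_bound M \<sigma> \<omega>"
      by (intro bilin_unit_le[OF s M]) auto
    then have "(a\<^sup>2 * b\<^sup>2 * (bilin M \<omega> u v)\<^sup>2) * (?U * ?V) \<le> op_norm_sq_bound M \<sigma> \<omega> * (?U * ?V)"
      unfolding bilin_scale using nn by (intro mult_right_mono) (auto simp: power_mult_distrib)
    also have "(a\<^sup>2 * b\<^sup>2 * (bilin M \<omega> u v)\<^sup>2) * (?U * ?V)
        = (a\<^sup>2 * ?U) * (b\<^sup>2 * ?V) * (bilin M \<omega> u v)\<^sup>2" by (simp only: mult_ac)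
    finally show ?thesis using ab by (simp add: mult_ac)
  qed
qed

lemma le_of_square_le:
  fixes s c :: real
  assumes "s\<^sup>2 \<le> c * s" "0 \<le> c" "0 \<le> s"
  shows "s \<le> c"
  using assms by (cases "s = 0") (auto simp: power2_eq_square mult_le_cancel_right)

text \<open>
  A row \<open>w\<close> of the product is the row \<open>a\<close> of \<open>A\<close> applied to the noise, so that \<open>\<bar>w\<bar>\<^sup>2\<close> is the
  bilinear form at \<open>a\<close> and \<open>w\<close>; in the bound for its square one factor \<open>\<bar>w\<bar>\<^sup>2\<close> cancels.
\<close>
lemma noise_left_mult_energy_le:
  assumes s: "\<sigma> > 0" and M: "M \<ge> 1" and A: "A \<in> carrier_mat M M"
  shows "hs_inner (A * noise M \<omega>) (A * noise M \<omega>) \<le> op_norm_sq_bound M \<sigma> \<omega> * hs_inner A A"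
proof -
  let ?w = "\<lambda>i j. \<Sum>l<M. A $$ (i, l) * \<omega> (l, j)"
  have row: "(\<Sum>j<M. (?w i j)\<^sup>2) \<le> op_norm_sq_bound M \<sigma> \<omega> * (\<Sum>l<M. (A $$ (i, l))\<^sup>2)" for i
  proof (rule le_of_square_le)
    have "bilin M \<omega> (\<lambda>l. A $$ (i, l)) (?w i) = (\<Sum>j<M. (?w i j)\<^sup>2)"
      unfolding bilin_right by (simp add: power2_eq_square)
    then show "(\<Sum>j<M. (?w i j)\<^sup>2)\<^sup>2
      \<le> op_norm_sq_bound M \<sigma> \<omega> * (\<Sum>l<M. (A $$ (i, l))\<^sup>2) * (\<Sum>j<M. (?w i j)\<^sup>2)"
      using bilin_le[OF s M, of \<omega> "\<lambda>l. A $$ (i, l)" "?w i"] by simp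
  qed (auto intro!: mult_nonneg_nonneg op_norm_sq_bound_nonneg sum_nonneg)
  have N: "noise M \<omega> \<in> carrier_mat M M" by simp
  have ent: "(A * noise M \<omega>) $$ (i, j) = ?w i j" if "i < M" "j < M" for i j
    unfolding mat_mult_index[OF A N that] using that by (intro sum.cong refl) simp
  have dims: "dim_row (A * noise M \<omega>) = M" "dim_col (A * noise M \<omega>) = M" "dim_row A = M" "dim_col A = M"
    using A by simp_all
  have "hs_inner (A * noise M \<omega>) (A * noise M \<omega>) = (\<Sum>i<M. \<Sum>j<M. (?w i j)\<^sup>2)"
    unfolding hs_inner_def dims power2_eq_square
    by (intro sum.cong refl arg_cong2[of _ _ _ _ "(*)"] ent) simp_all
  also have "\<dots> \<le> (\<Sum>i<M. op_norm_sq_bound M \<sigma> \<omega> * (\<Sum>l<M. (A $$ (i, l))\<^sup>2))"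
    by (intro sum_mono row)
  also have "\<dots> = op_norm_sq_bound M \<sigma> \<omega> * hs_inner A A"
    unfolding hs_inner_def dims by (simp add: sum_distrib_left power2_eq_square)
  finally show ?thesis .
qed

lemma noise_right_mult_energy_le:
  assumes s: "\<sigma> > 0" and M: "M \<ge> 1" and A: "A \<in> carrier_mat M M"
  shows "hs_inner (noise M \<omega> * A) (noise M \<omega> * A) \<le> op_norm_sq_bound M \<sigma> \<omega> * hs_inner A A"
proof -
  let ?w = "\<lambda>i j. \<Sum>l<M. \<omega> (i, l) * A $$ (l, j)"
  have col: "(\<Sum>i<M. (?w i j)\<^sup>2) \<le> op_norm_sq_bound M \<sigma> \<omega> * (\<Sum>l<M. (A $$ (l, j))\<^sup>2)" for j
  proof (rule le_of_square_le)
    have "bilin M \<omega> (\<lambda>i. ?w i j) (\<lambda>l. A $$ (l, j)) = (\<Sum>i<M. (?w i j)\<^sup>2)"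
      unfolding bilin_left by (simp add: power2_eq_square)
    then show "(\<Sum>i<M. (?w i j)\<^sup>2)\<^sup>2
      \<le> op_norm_sq_bound M \<sigma> \<omega> * (\<Sum>l<M. (A $$ (l, j))\<^sup>2) * (\<Sum>i<M. (?w i j)\<^sup>2)"
      using bilin_le[OF s M, of \<omega> "\<lambda>i. ?w i j" "\<lambda>l. A $$ (l, j)"] by (simp add: mult_ac)
  qed (auto intro!: mult_nonneg_nonneg op_norm_sq_bound_nonneg sum_nonneg)
  have N: "noise M \<omega> \<in> carrier_mat M M" by simp
  have ent: "(noise M \<omega> * A) $$ (i, j) = ?w i j" if "i < M" "j < M" for i j
    unfolding mat_mult_index[OF N A that] using that by (intro sum.cong refl) simp
  have dims: "dim_row (noise M \<omega> * A) = M" "dim_col (noise M \<omega> * A) = M" "dim_row A = M" "dim_col A = M"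
    using A by simp_all
  have "hs_inner (noise M \<omega> * A) (noise M \<omega> * A) = (\<Sum>i<M. \<Sum>j<M. (?w i j)\<^sup>2)"
    unfolding hs_inner_def dims power2_eq_square
    by (intro sum.cong refl arg_cong2[of _ _ _ _ "(*)"] ent) simp_all
  also have "\<dots> = (\<Sum>j<M. \<Sum>i<M. (?w i j)\<^sup>2)" by (rule sum.swap)
  also have "\<dots> \<le> (\<Sum>j<M. op_norm_sq_bound M \<sigma> \<omega> * (\<Sum>l<M. (A $$ (l, j))\<^sup>2))"
    by (intro sum_mono col)
  also have "\<dots> = op_norm_sq_bound M \<sigma> \<omega> * (\<Sum>j<M. \<Sum>l<M. (A $$ (l, j))\<^sup>2)"
    by (simp add: sum_distrib_left)
  also have "(\<Sum>j<M. \<Sum>l<M. (A $$ (l, j))\<^sup>2) = (\<Sum>l<M. \<Sum>j<M. (A $$ (l, j))\<^sup>2)" by (rule sum.swap)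
  also have "\<dots> = hs_inner A A"
    unfolding hs_inner_def dims by (simp add: power2_eq_square)
  finally show ?thesis .
qed

section \<open>Uniform upper bound for the excess energy\<close>

lemma proj_mult_inner:
  assumes P: "P \<in> proj_mats M r" and A: "A \<in> carrier_mat M m" and B: "B \<in> carrier_mat M m"
  shows "hs_inner (P * A) (P * B) = hs_inner (P * A) B"
proof -
  note p = proj_matsD[OF P]
  have PA: "P * A \<in> carrier_mat M m" and PB: "P * B \<in> carrier_mat M m" using p A B by simp_all
  have "hs_inner (P * A) (P * B) = hs_inner (P * B) (P * A)" by (rule hs_inner_commute[OF PA PB])
  also have "\<dots> = hs_inner B (transpose_mat P * (P * A))"
    by (rule hs_inner_mult_left_adjoint[OF p(1) B PA])
  also have "transpose_mat P * (P * A) = P * A"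
    unfolding p(2) using assoc_mult_mat[OF p(1) p(1) A] p(3) by simp
  also have "hs_inner B (P * A) = hs_inner (P * A) B" by (rule hs_inner_commute[OF B PA])
  finally show ?thesis .
qed

lemma proj_Pythagoras:
  assumes P: "P \<in> proj_mats M r" and A: "A \<in> carrier_mat M m"
  shows "hs_inner A A = hs_inner (P * A) (P * A) + hs_inner (A - P * A) (A - P * A)"
proof -
  note p = proj_matsD[OF P]
  have PA: "P * A \<in> carrier_mat M m" using p A by simp
  have D: "A - P * A \<in> carrier_mat M m" using PA by (rule minus_carrier_mat)
  show ?thesis
    using proj_mult_inner[OF P A A] hs_inner_commute[OF PA A]
    by (simp add: hs_inner_diff_left[OF A PA] hs_inner_diff_right[OF A PA A] hs_inner_diff_right[OF A PA PA])
qed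

lemma proj_energy_le:
  assumes "P \<in> proj_mats M r" "A \<in> carrier_mat M m"
  shows "hs_inner (P * A) (P * A) \<le> hs_inner A A"
  using proj_Pythagoras[OF assms] by simp

definition coord_proj :: "nat \<Rightarrow> nat \<Rightarrow> real mat" where
  "coord_proj M s = mat_diag M (\<lambda>i. if i < s then 1 else 0)"

lemma coord_proj_carrier [simp]: "coord_proj M s \<in> carrier_mat M M"
  by (simp add: coord_proj_def)

lemma C_mat_eq: "C_mat M \<alpha> s = \<alpha> \<cdot>\<^sub>m coord_proj M s"
  by (auto simp: C_mat_def coord_proj_def mat_diag_def intro!: eq_matI)

lemma coord_proj_in_proj_mats:
  assumes "s \<le> M"
  shows "coord_proj M s \<in> proj_mats M s"
proof -
  have 1: "transpose_mat (coord_proj M s) = coord_proj M s"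
    by (intro eq_matI) (auto simp: coord_proj_def mat_diag_def)
  have 2: "coord_proj M s * coord_proj M s = coord_proj M s"
    unfolding coord_proj_def mat_diag_mult_left[OF mat_diag_dim]
    by (intro eq_matI) (auto simp: mat_diag_def)
  have "hs_inner (coord_proj M s) (coord_proj M s) = (\<Sum>i<M. \<Sum>j<M. if i = j then (if i < s then 1 else 0) else 0)"
    unfolding hs_inner_def coord_proj_def mat_diag_def dim_row_mat dim_col_mat
    by (intro sum.cong refl) simp
  also have "\<dots> = (\<Sum>i<M. if i < s then 1 else 0)"
    by (intro sum.cong refl, subst sum.delta') simp_all
  also have "\<dots> = (\<Sum>i\<in>{..<M} \<inter> {i. i < s}. 1)" by (subst sum.inter_restrict) simp_all
  also have "{..<M} \<inter> {i. i < s} = {..<s}" using assms by auto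
  finally have 3: "hs_inner (coord_proj M s) (coord_proj M s) = real s" by simp
  show ?thesis unfolding proj_mats_def using 1 2 3 by simp
qed

lemma observation_C_mat: "observation (C_mat M \<alpha> s) M \<omega> = \<alpha> \<cdot>\<^sub>m coord_proj M s + noise M \<omega>"
  by (simp add: observation_def C_mat_eq)

lemma C_mat_carrier [simp]: "C_mat M \<alpha> s \<in> carrier_mat M M"
  by (simp add: C_mat_def)

lemma population_energy:
  assumes s: "\<sigma> > 0" and P: "P \<in> proj_mats M r" and C: "C \<in> carrier_mat M M"
  shows "has_bochner_integral (gaussian_law M \<sigma>)
    (\<lambda>\<omega>. hs_inner (P * observation C M \<omega>) (P * observation C M \<omega>))
    (hs_inner (P * C) (P * C) + \<sigma>\<^sup>2 * real r * real M)"
proof -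
  note p = proj_matsD[OF P]
  have N: "noise M \<omega> \<in> carrier_mat M M" for \<omega> by simp
  have PC: "P * C \<in> carrier_mat M M" and PN: "P * noise M \<omega> \<in> carrier_mat M M" for \<omega> using p C by simp_all
  have one: "1 \<cdot>\<^sub>m (P * C) = P * C" by (intro eq_matI) simp_all
  have e: "hs_inner (P * observation C M \<omega>) (P * observation C M \<omega>)
      = hs_inner (P * C) (P * C) + 2 * hs_inner (P * C) (noise M \<omega>)
        + hs_inner (P * noise M \<omega> * 1\<^sub>m M) (P * noise M \<omega> * 1\<^sub>m M)" for \<omega>
    unfolding observation_def mult_add_distrib_mat[OF p(1) C N] right_mult_one_mat[OF PN]
      proj_mult_inner[OF P C N, symmetric]
    using hs_inner_smult_add_self[OF PC PN, of 1] unfolding one by simp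
  interpret prob_space "gaussian_law M \<sigma>" by (rule prob_space_gaussian_law[OF s])
  have c: "has_bochner_integral (gaussian_law M \<sigma>) (\<lambda>\<omega>. hs_inner (P * C) (P * C)) (hs_inner (P * C) (P * C))"
    by (simp add: has_bochner_integral_iff prob_space)
  have "has_bochner_integral (gaussian_law M \<sigma>)
    (\<lambda>\<omega>. hs_inner (P * observation C M \<omega>) (P * observation C M \<omega>))
    (hs_inner (P * C) (P * C) + 2 * 0 + \<sigma>\<^sup>2 * hs_inner P P * hs_inner (1\<^sub>m M) (1\<^sub>m M))"
    unfolding e
    by (intro has_bochner_integral_add has_bochner_integral_mult_right c noise_linear[OF PC s]
        noise_energy[OF p(1) one_carrier_mat s])
  then show ?thesis by (simp add: p(4) hs_inner_one_mat)
qed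

text \<open>
  The noise contributes \<open>\<sigma>\<^sup>2 * r * M\<close> for every projection of rank \<open>r\<close>, so only the signal decides,
  and projections do not increase the energy of \<open>coord_proj M r\<close>.
\<close>
lemma population_value:
  assumes s: "\<sigma> > 0" and r: "r \<le> M"
  shows "(\<integral>\<omega>. (hs_norm (population_proj (C_mat M \<alpha> r) M \<sigma> r * observation (C_mat M \<alpha> r) M \<omega>))\<^sup>2
            \<partial>gaussian_law M \<sigma>) = \<alpha>\<^sup>2 * real r + \<sigma>\<^sup>2 * real r * real M"
proof -
  let ?C = "C_mat M \<alpha> r" and ?P0 = "coord_proj M r"
  have P0: "?P0 \<in> proj_mats M r" by (rule coord_proj_in_proj_mats[OF r])
  let ?F = "\<lambda>P. \<integral>\<omega>. hs_inner (P * observation ?C M \<omega>) (P * observation ?C M \<omega>) \<partial>gaussian_law M \<sigma>"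
  have F: "?F P = \<alpha>\<^sup>2 * hs_inner (P * ?P0) (P * ?P0) + \<sigma>\<^sup>2 * real r * real M" if P: "P \<in> proj_mats M r" for P
  proof -
    have PP: "P * ?P0 \<in> carrier_mat M M" using proj_matsD(1)[OF P] by simp
    have "P * ?C = \<alpha> \<cdot>\<^sub>m (P * ?P0)"
      unfolding C_mat_eq by (rule mult_smult_distrib[OF proj_matsD(1)[OF P] coord_proj_carrier])
    then have "hs_inner (P * ?C) (P * ?C) = \<alpha>\<^sup>2 * hs_inner (P * ?P0) (P * ?P0)"
      by (simp add: hs_inner_smult_left hs_inner_smult_left[OF PP] hs_inner_smult_right[OF PP PP]
          hs_inner_smult_right[OF PP smult_carrier_mat[OF PP]] power2_eq_square)
    then show ?thesis
      using has_bochner_integral_integral_eq[OF population_energy[OF s P, of ?C]] by simp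
  qed
  have le: "?F P \<le> ?F ?P0" if P: "P \<in> proj_mats M r" for P
    unfolding F[OF P] F[OF P0] proj_matsD(3)[OF P0]
    using proj_energy_le[OF P, of ?P0 M] by (intro add_right_mono mult_left_mono) simp_all
  have "?F (arg_max ?F (\<lambda>P. P \<in> proj_mats M r)) = ?F ?P0"
    by (rule arg_max_equality[where f = ?F and P = "\<lambda>P. P \<in> proj_mats M r" and k = ?P0]) (use P0 le in blast)+
  then have "(\<integral>\<omega>. (hs_norm (population_proj ?C M \<sigma> r * observation ?C M \<omega>))\<^sup>2 \<partial>gaussian_law M \<sigma>) = ?F ?P0"
    unfolding population_proj_def arg_max_on_def hs_norm_sq orth_projs_eq .
  also have "\<dots> = \<alpha>\<^sup>2 * real r + \<sigma>\<^sup>2 * real r * real M"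
    unfolding F[OF P0] proj_matsD(3)[OF P0] proj_matsD(4)[OF P0] ..
  finally show ?thesis .
qed

definition max_energy :: "nat \<Rightarrow> nat \<Rightarrow> real mat \<Rightarrow> real" where
  "max_energy M r X = hs_inner (empirical_proj M r X * X) (empirical_proj M r X * X)"

lemma delta_eq:
  assumes "\<sigma> > 0" "r \<le> M"
  shows "delta (C_mat M \<alpha> r) M \<sigma> r
    = (\<integral>\<omega>. max_energy M r (observation (C_mat M \<alpha> r) M \<omega>) \<partial>gaussian_law M \<sigma>)
      - (\<alpha>\<^sup>2 * real r + \<sigma>\<^sup>2 * real r * real M)"
  unfolding delta_def population_value[OF assms] unfolding hs_norm_sq max_energy_def ..

text \<open>
  With \<open>D = P0 - P * P0\<close>, moving away from \<open>P0\<close> costs \<open>\<alpha>\<^sup>2 * \<bar>D\<bar>\<^sup>2\<close> of signal energy and gains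
  the cross term \<open>- 2 * \<alpha> * hs_inner D E\<close>. Completing the square bounds the balance by the
  energy of \<open>E * P0\<close>, uniformly in \<open>\<alpha>\<close>. Both this energy and that of \<open>P * E\<close> are at most \<open>r\<close>
  times the squared operator norm of \<open>E\<close>.
\<close>
lemma energy_le:
  fixes \<alpha> :: real and \<omega> :: "nat \<times> nat \<Rightarrow> real"
  assumes s: "\<sigma> > 0" and M: "M \<ge> 1" and r: "r \<le> M" and P: "P \<in> proj_mats M r"
  defines "P0 \<equiv> coord_proj M r"
  defines "X \<equiv> \<alpha> \<cdot>\<^sub>m P0 + noise M \<omega>"
  shows "hs_inner (P * X) (P * X)
    \<le> \<alpha>\<^sup>2 * real r + 2 * \<alpha> * hs_inner P0 (noise M \<omega>) + 2 * real r * op_norm_sq_bound M \<sigma> \<omega>"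
proof -
  let ?E = "noise M \<omega>" and ?\<Phi> = "op_norm_sq_bound M \<sigma> \<omega>"
  note p = proj_matsD[OF P]
  have P0: "P0 \<in> proj_mats M r" unfolding P0_def by (rule coord_proj_in_proj_mats[OF r])
  note p0 = proj_matsD[OF P0]
  have E: "?E \<in> carrier_mat M M" by simp
  have PP0: "P * P0 \<in> carrier_mat M M" and PE: "P * ?E \<in> carrier_mat M M"
    and aP0: "\<alpha> \<cdot>\<^sub>m P0 \<in> carrier_mat M M"
    using p p0 by simp_all
  have EP0: "?E * P0 \<in> carrier_mat M M" by (rule mult_carrier_mat[OF E p0(1)])
  define D where "D = P0 - P * P0"
  have D: "D \<in> carrier_mat M M" unfolding D_def using PP0 by (rule minus_carrier_mat)
  have PX: "P * X = \<alpha> \<cdot>\<^sub>m (P * P0) + P * ?E"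
    unfolding X_def mult_add_distrib_mat[OF p(1) aP0 E] mult_smult_distrib[OF p(1) p0(1)] ..
  have 1: "hs_inner (P * X) (P * X)
      = \<alpha>\<^sup>2 * hs_inner (P * P0) (P * P0) + 2 * \<alpha> * hs_inner (P * P0) ?E + hs_inner (P * ?E) (P * ?E)"
    unfolding PX hs_inner_smult_add_self[OF PP0 PE] proj_mult_inner[OF P p0(1) E] ..
  have 2: "hs_inner (P * P0) (P * P0) = real r - hs_inner D D"
    using proj_Pythagoras[OF P p0(1)] p0(4) unfolding D_def by simp
  have 3: "hs_inner (P * P0) ?E = hs_inner P0 ?E - hs_inner D ?E"
    unfolding D_def by (simp add: hs_inner_diff_left[OF p0(1) PP0])
  have "D * P0 = D"
    unfolding D_def minus_mult_distrib_mat[OF p0(1) PP0 p0(1)] assoc_mult_mat[OF p(1) p0(1) p0(1)] p0(3) ..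
  then have "hs_inner D ?E = hs_inner (D * P0) ?E" by simp
  also have "\<dots> = hs_inner D (?E * P0)"
    using hs_inner_mult_right_adjoint[OF D p0(1) E] unfolding p0(2) .
  finally have 4: "hs_inner D ?E = hs_inner D (?E * P0)" .
  have "0 \<le> hs_inner (\<alpha> \<cdot>\<^sub>m D + ?E * P0) (\<alpha> \<cdot>\<^sub>m D + ?E * P0)" by simp
  also have "\<dots> = \<alpha>\<^sup>2 * hs_inner D D + 2 * \<alpha> * hs_inner D (?E * P0) + hs_inner (?E * P0) (?E * P0)"
    by (rule hs_inner_smult_add_self[OF D EP0])
  finally have 5: "- (\<alpha>\<^sup>2 * hs_inner D D) - 2 * \<alpha> * hs_inner D ?E \<le> hs_inner (?E * P0) (?E * P0)"
    unfolding 4 by linarith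
  have 6: "hs_inner (?E * P0) (?E * P0) \<le> ?\<Phi> * real r"
    using noise_right_mult_energy_le[OF s M p0(1)] unfolding p0(4) .
  have 7: "hs_inner (P * ?E) (P * ?E) \<le> ?\<Phi> * real r"
    using noise_left_mult_energy_le[OF s M p(1)] unfolding p(4) .
  show ?thesis unfolding 1 2 3 using 5 6 7 by (simp add: algebra_simps)
qed

lemma max_energy_integrable_le:
  assumes s: "\<sigma> > 0" and M: "M \<ge> 1" and r: "r \<le> M"
  shows "integrable (gaussian_law M \<sigma>) (\<lambda>\<omega>. max_energy M r (observation (C_mat M \<alpha> r) M \<omega>))"
    and "(\<integral>\<omega>. max_energy M r (observation (C_mat M \<alpha> r) M \<omega>) \<partial>gaussian_law M \<sigma>)
      \<le> \<alpha>\<^sup>2 * real r + 2 * real r * (804 * \<sigma>\<^sup>2 * real M)"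
proof -
  let ?P0 = "coord_proj M r" and ?m = "\<lambda>\<omega>. max_energy M r (observation (C_mat M \<alpha> r) M \<omega>)"
  let ?b = "\<lambda>\<omega>. \<alpha>\<^sup>2 * real r + 2 * \<alpha> * hs_inner ?P0 (noise M \<omega>) + 2 * real r * op_norm_sq_bound M \<sigma> \<omega>"
  interpret prob_space "gaussian_law M \<sigma>" by (rule prob_space_gaussian_law[OF s])
  have ne: "proj_mats M r \<noteq> {}" using coord_proj_in_proj_mats[OF r] by auto
  have le: "?m \<omega> \<le> ?b \<omega>" for \<omega>
    using energy_le[OF s M r empirical_proj_in[OF ne, of "observation (C_mat M \<alpha> r) M \<omega>"], of \<alpha> \<omega>]
    unfolding max_energy_def by (simp add: observation_C_mat)
  have const: "has_bochner_integral (gaussian_law M \<sigma>) (\<lambda>_. \<alpha>\<^sup>2 * real r) (\<alpha>\<^sup>2 * real r)"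
    by (simp add: has_bochner_integral_iff prob_space)
  have B: "has_bochner_integral (gaussian_law M \<sigma>) ?b
      (\<alpha>\<^sup>2 * real r + 2 * \<alpha> * 0 + 2 * real r * (\<integral>\<omega>. op_norm_sq_bound M \<sigma> \<omega> \<partial>gaussian_law M \<sigma>))"
    by (rule has_bochner_integral_add[OF has_bochner_integral_add[OF const
          has_bochner_integral_mult_right[OF noise_linear[OF coord_proj_carrier s]]]
          has_bochner_integral_mult_right[OF has_bochner_integral_integrable[OF
              op_norm_sq_bound_expectation(1)[OF s M]]]])
  then have Bi: "integrable (gaussian_law M \<sigma>) ?b" by (rule integrable.intros)
  have meas: "?m \<in> borel_measurable (gaussian_law M \<sigma>)"
    unfolding max_energy_def by (rule measurable_empirical_energy[OF ne C_mat_carrier])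
  show int: "integrable (gaussian_law M \<sigma>) ?m"
  proof (rule Bochner_Integration.integrable_bound[OF Bi meas], intro AE_I2)
    fix \<omega>
    have "0 \<le> ?m \<omega>" unfolding max_energy_def by simp
    then show "norm (?m \<omega>) \<le> norm (?b \<omega>)" using le[of \<omega>] by simp
  qed
  have "(\<integral>\<omega>. ?m \<omega> \<partial>gaussian_law M \<sigma>) \<le> (\<integral>\<omega>. ?b \<omega> \<partial>gaussian_law M \<sigma>)"
    by (rule integral_mono[OF int Bi le])
  also have "\<dots> = \<alpha>\<^sup>2 * real r + 2 * real r * (\<integral>\<omega>. op_norm_sq_bound M \<sigma> \<omega> \<partial>gaussian_law M \<sigma>)"
    using has_bochner_integral_integral_eq[OF B] by simp
  also have "\<dots> \<le> \<alpha>\<^sup>2 * real r + 2 * real r * (804 * \<sigma>\<^sup>2 * real M)"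
    using op_norm_sq_bound_expectation(2)[OF s M] by (intro add_left_mono mult_left_mono) auto
  finally show "(\<integral>\<omega>. ?m \<omega> \<partial>gaussian_law M \<sigma>) \<le> \<alpha>\<^sup>2 * real r + 2 * real r * (804 * \<sigma>\<^sup>2 * real M)" .
qed

lemma delta_upper_bound:
  assumes s: "\<sigma> > 0" and M: "M \<ge> 1" and r: "r \<le> M"
  shows "delta (C_mat M \<alpha> r) M \<sigma> r \<le> 1608 * \<sigma>\<^sup>2 * real r * real M"
proof -
  have "0 \<le> \<sigma>\<^sup>2 * real r * real M" by simp
  moreover have "2 * real r * (804 * \<sigma>\<^sup>2 * real M) = 1608 * \<sigma>\<^sup>2 * real r * real M" by simp
  ultimately show ?thesis
    unfolding delta_eq[OF s r] using max_energy_integrable_le(2)[OF assms, of \<alpha>] by linarith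
qed

section \<open>Lower bound for strong signals\<close>

text \<open>
  The quadratic form of this matrix at \<open>v\<close> is \<open>\<bar>v\<bar>\<^sup>2 + \<bar>B v\<bar>\<^sup>2\<close>, so its kernel is trivial.
\<close>
lemma one_plus_gram_invertible:
  fixes B :: "real mat"
  assumes B: "B \<in> carrier_mat M M"
  obtains K where "K \<in> carrier_mat M M" "K * (1\<^sub>m M + transpose_mat B * B) = 1\<^sub>m M"
    "(1\<^sub>m M + transpose_mat B * B) * K = 1\<^sub>m M"
proof -
  let ?S = "1\<^sub>m M + transpose_mat B * B"
  have BT: "transpose_mat B \<in> carrier_mat M M" using B by simp
  have BB: "transpose_mat B * B \<in> carrier_mat M M" by (rule mult_carrier_mat[OF BT B])
  have S: "?S \<in> carrier_mat M M" using BB by simp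
  have "det ?S \<noteq> 0"
  proof
    assume "det ?S = 0"
    then obtain v where v: "v \<in> carrier_vec M" "v \<noteq> 0\<^sub>v M" "?S *\<^sub>v v = 0\<^sub>v M"
      unfolding det_0_iff_vec_prod_zero_field[OF S] by blast
    have Bv: "B *\<^sub>v v \<in> carrier_vec M" using B v by simp
    have "0\<^sub>v M = v + transpose_mat B *\<^sub>v (B *\<^sub>v v)"
      using v(3) unfolding add_mult_distrib_mat_vec[OF one_carrier_mat BB v(1)]
        assoc_mult_mat_vec[OF BT B v(1)] one_mult_mat_vec[OF v(1)] by simp
    from arg_cong[OF this, of "\<lambda>w. scalar_prod w v"]
    have "scalar_prod (v + transpose_mat B *\<^sub>v (B *\<^sub>v v)) v = 0"
      using scalar_prod_left_zero[OF v(1)] by simp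
    moreover have "scalar_prod (v + transpose_mat B *\<^sub>v (B *\<^sub>v v)) v
        = scalar_prod v v + scalar_prod (B *\<^sub>v v) (B *\<^sub>v v)"
      using transpose_vec_mult_scalar[OF B v(1) Bv] add_scalar_prod_distrib[OF v(1) _ v(1)]
        mult_mat_vec_carrier[OF BT Bv] by simp
    ultimately have "scalar_prod v v = 0"
      using scalar_prod_self_nonneg[of v] scalar_prod_self_nonneg[of "B *\<^sub>v v"] by linarith
    then show False using scalar_prod_self_eq_0D[OF v(1)] v(2) by blast
  qed
  from det_non_zero_imp_unit[OF S this, of "()"]
  obtain K where "K \<in> carrier_mat M M" "K * ?S = 1\<^sub>m M" "?S * K = 1\<^sub>m M"
    unfolding Units_def ring_mat_def by auto
  then show ?thesis by (rule that)
qed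

text \<open>
  The projection onto the graph of \<open>B\<close> over the range of \<open>P0\<close>. With \<open>W = P0 + B\<close> one has
  \<open>W\<^sup>T * W = P0 + B\<^sup>T * B = S * P0\<close> for the invertible matrix \<open>S = 1 + B\<^sup>T * B\<close>, and
  \<open>W * inverse S * W\<^sup>T\<close> is the usual least-squares formula.
\<close>
lemma graph_projection:
  assumes P0: "P0 \<in> proj_mats M s" and B: "B \<in> carrier_mat M M"
    and BP: "B * P0 = B" and PB: "P0 * B = 0\<^sub>m M M"
  obtains P where "P \<in> proj_mats M s" "P * (P0 + B) = P0 + B"
proof -
  note p0 = proj_matsD[OF P0]
  define BB where "BB = transpose_mat B * B"
  define W where "W = P0 + B"
  define S where "S = 1\<^sub>m M + BB"
  obtain K where K: "K \<in> carrier_mat M M" and KS: "K * S = 1\<^sub>m M" and SK: "S * K = 1\<^sub>m M"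
    by (rule one_plus_gram_invertible[OF B]) (rule that; simp only: S_def BB_def)
  have BT: "transpose_mat B \<in> carrier_mat M M" using B by simp
  have BB: "BB \<in> carrier_mat M M" unfolding BB_def by (rule mult_carrier_mat[OF BT B])
  have W: "W \<in> carrier_mat M M" unfolding W_def using p0(1) B by simp
  have WT: "transpose_mat W \<in> carrier_mat M M" using W by simp
  have S: "S \<in> carrier_mat M M" unfolding S_def using BB by simp
  note as = assoc_mult_mat[of _ M M _ M _ M]
  have "transpose_mat S = S"
    unfolding S_def BB_def using transpose_add[OF one_carrier_mat BB[unfolded BB_def]]
      transpose_mult[OF BT B] by simp
  have KT: "transpose_mat K = K"
  proof -
    have KTc: "transpose_mat K \<in> carrier_mat M M" using K by simp
    have "transpose_mat K * S = 1\<^sub>m M"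
      using transpose_mult[OF S K] SK \<open>transpose_mat S = S\<close> by simp
    then have "transpose_mat K * S * K = K" using K by simp
    then show ?thesis using as[OF KTc S K] SK KTc by simp
  qed
  have "transpose_mat B * P0 = transpose_mat (P0 * B)" using transpose_mult[OF p0(1) B] p0(2) by simp
  then have BTP: "transpose_mat B * P0 = 0\<^sub>m M M" unfolding PB by auto
  have WTe: "transpose_mat W = P0 + transpose_mat B"
    unfolding W_def using transpose_add[OF p0(1) B] p0(2) by simp
  have WTP: "transpose_mat W * P0 = P0"
    unfolding WTe add_mult_distrib_mat[OF p0(1) BT p0(1)] BTP p0(3) using p0(1) by simp
  have WTB: "transpose_mat W * B = BB"
    unfolding WTe add_mult_distrib_mat[OF p0(1) BT B] PB BB_def[symmetric] using BB by simp
  have WP0: "W * P0 = W" unfolding W_def add_mult_distrib_mat[OF p0(1) B p0(1)] BP p0(3) ..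
  have "BB * P0 = BB" unfolding BB_def as[OF BT B p0(1)] BP ..
  then have SP0: "S * P0 = P0 + BB"
    unfolding S_def add_mult_distrib_mat[OF one_carrier_mat BB p0(1)] using p0(1) by simp
  have "transpose_mat W * W = transpose_mat W * P0 + transpose_mat W * B"
    using mult_add_distrib_mat[OF WT p0(1) B] by (simp only: W_def)
  then have gram: "transpose_mat W * W = S * P0"
    unfolding WTP WTB SP0 .
  have KW: "K * transpose_mat W \<in> carrier_mat M M" and WK: "W * K \<in> carrier_mat M M"
    using mult_carrier_mat[OF K WT] mult_carrier_mat[OF W K] by simp_all
  define P where "P = W * (K * transpose_mat W)"
  have P: "P \<in> carrier_mat M M" unfolding P_def by (rule mult_carrier_mat[OF W KW])
  have "K * transpose_mat W * W = K * (S * P0)" unfolding as[OF K WT W] gram ..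
  also have "\<dots> = P0" using as[OF K S p0(1)] KS p0(1) by simp
  finally have KWW: "K * transpose_mat W * W = P0" .
  have PW: "P * W = W" unfolding P_def as[OF W KW W] KWW WP0 ..
  have PP: "P * P = P"
  proof -
    have "P * P = P * W * (K * transpose_mat W)"
      unfolding as[OF P W KW] by (simp only: P_def)
    then show ?thesis unfolding PW by (simp only: P_def)
  qed
  have PT: "transpose_mat P = P"
    unfolding P_def transpose_mult[OF W KW] transpose_mult[OF K WT] transpose_transpose KT
    by (rule as[OF W K WT])
  have "hs_inner P P = hs_inner (P * 1\<^sub>m M) P" using P by simp
  also have "\<dots> = hs_inner (1\<^sub>m M) (transpose_mat P * P)"
    by (rule hs_inner_mult_left_adjoint[OF P one_carrier_mat P])
  also have "\<dots> = hs_inner P (1\<^sub>m M)" unfolding PT PP by (rule hs_inner_commute[OF one_carrier_mat P])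
  also have "\<dots> = hs_inner (W * K * transpose_mat W) (1\<^sub>m M)" unfolding P_def as[OF W K WT] ..
  also have "\<dots> = hs_inner (W * K) (1\<^sub>m M * W)"
    using hs_inner_mult_right_adjoint[OF WK WT one_carrier_mat] by simp
  also have "\<dots> = hs_inner (W * K) W" using W by simp
  also have "\<dots> = hs_inner K (S * P0)"
    unfolding gram[symmetric] by (rule hs_inner_mult_left_adjoint[OF W K W])
  also have "\<dots> = hs_inner (S * P0) K"
    by (rule hs_inner_commute[OF K mult_carrier_mat[OF S p0(1)]])
  also have "\<dots> = hs_inner P0 (transpose_mat S * K)"
    by (rule hs_inner_mult_left_adjoint[OF S p0(1) K])
  also have "\<dots> = hs_inner P0 (1\<^sub>m M)" unfolding \<open>transpose_mat S = S\<close> SK ..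
  also have "\<dots> = hs_inner P0 P0"
    using proj_mult_inner[OF P0 p0(1) one_carrier_mat] p0 by simp
  finally have "hs_inner P P = real s" using p0(4) by simp
  then have "P \<in> proj_mats M s" unfolding proj_mats_def using P PP PT by simp
  then show ?thesis using PW unfolding W_def by (rule that)
qed

text \<open>
  One half of the Eckart-Young principle: among all matrices with columns in the range of \<open>P\<close>,
  the matrix \<open>P * X\<close> is closest to \<open>X\<close>. A lower bound for the energy therefore needs only one
  good approximation \<open>Y\<close>, not the optimal one.
\<close>
lemma energy_ge_approximation:
  assumes P: "P \<in> proj_mats M s" and X: "X \<in> carrier_mat M m" and Y: "Y \<in> carrier_mat M m"
    and PY: "P * Y = Y"
  shows "hs_inner X X - hs_inner (X - Y) (X - Y) \<le> hs_inner (P * X) (P * X)"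
proof -
  note p = proj_matsD[OF P]
  have PX: "P * X \<in> carrier_mat M m" using p X by simp
  have D: "X - Y \<in> carrier_mat M m" using Y by (rule minus_carrier_mat)
  have cancel: "A - A' = (A - Y) - (A' - Y)" if "A \<in> carrier_mat M m" "A' \<in> carrier_mat M m" for A A'
    using that Y by (intro eq_matI) auto
  have "X - P * X = (X - Y) - P * (X - Y)"
    unfolding mult_minus_distrib_mat[OF p(1) X Y] PY by (rule cancel[OF X PX])
  from arg_cong[OF this, of "\<lambda>A. hs_inner A A"]
  have "hs_inner (X - P * X) (X - P * X) \<le> hs_inner (X - Y) (X - Y)"
    using proj_Pythagoras[OF P D] hs_inner_self_nonneg[of "P * (X - Y)"] by linarith
  then show ?thesis using proj_Pythagoras[OF P X] by linarith
qed

lemma coord_proj_complement_energy: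
  assumes "s \<le> M"
  shows "hs_inner (1\<^sub>m M - coord_proj M s) (1\<^sub>m M - coord_proj M s) = real (M - s)"
  using proj_Pythagoras[OF coord_proj_in_proj_mats[OF assms] one_carrier_mat]
  unfolding right_mult_one_mat[OF coord_proj_carrier] hs_inner_one_mat
    proj_matsD(4)[OF coord_proj_in_proj_mats[OF assms]] of_nat_diff[OF assms] by linarith

text \<open>
  Write \<open>E\<close> for the noise and \<open>t = 1 / \<alpha>\<close>. To first order in \<open>t\<close> the leading left singular
  space of \<open>X\<close> is the graph of \<open>t * G\<close> with \<open>G = Q * E * P0\<close>. For \<open>Y = (P0 + t * G) * P0 * X\<close>
  the remainder \<open>X - Y\<close> equals \<open>Q * E * Q - t * G * E\<close>: the block \<open>G\<close> of the noise has been
  absorbed into the projection, and its energy is gained up to terms of order \<open>t\<close>. The error is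
  kept explicit and polynomial in the energy of the noise, so that it can be integrated.
\<close>
lemma perturbed_energy_ge:
  fixes \<alpha> :: real and \<omega> :: "nat \<times> nat \<Rightarrow> real"
  assumes s: "s \<le> M" and a: "\<alpha> \<noteq> 0"
  defines "P0 \<equiv> coord_proj M s" and "N \<equiv> hs_inner (noise M \<omega>) (noise M \<omega>)"
  defines "Q \<equiv> 1\<^sub>m M - P0"
  defines "X \<equiv> \<alpha> \<cdot>\<^sub>m P0 + noise M \<omega>"
  obtains P where "P \<in> proj_mats M s"
    "hs_inner (P0 * X) (P0 * X) + hs_inner (Q * noise M \<omega> * P0) (Q * noise M \<omega> * P0)
       - (\<bar>1 / \<alpha>\<bar> * N + (\<bar>1 / \<alpha>\<bar> + (1 / \<alpha>)\<^sup>2) * N\<^sup>2)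
     \<le> hs_inner (P * X) (P * X)"
proof -
  let ?E = "noise M \<omega>"
  define t where "t = 1 / \<alpha>"
  have P0: "P0 \<in> proj_mats M s" unfolding P0_def by (rule coord_proj_in_proj_mats[OF s])
  note p0 = proj_matsD[OF P0]
  note as = assoc_mult_mat[of _ M M _ M _ M]
  have E: "?E \<in> carrier_mat M M" by simp
  have Q: "Q \<in> carrier_mat M M" unfolding Q_def using p0(1) by (rule minus_carrier_mat)
  have QP0: "Q * P0 = 0\<^sub>m M M"
    unfolding Q_def minus_mult_distrib_mat[OF one_carrier_mat p0(1) p0(1)] p0(3)
    using p0(1) by (intro eq_matI) auto
  have P0Q: "P0 * Q = 0\<^sub>m M M"
    unfolding Q_def mult_minus_distrib_mat[OF p0(1) one_carrier_mat p0(1)] p0(3)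
    using p0(1) by (intro eq_matI) auto
  have QA: "Q * A = A - P0 * A" if "A \<in> carrier_mat M M" for A
    unfolding Q_def minus_mult_distrib_mat[OF one_carrier_mat p0(1) that] using that by simp
  have QE: "Q * ?E \<in> carrier_mat M M" by (rule mult_carrier_mat[OF Q E])
  define G where "G = Q * ?E * P0"
  have G: "G \<in> carrier_mat M M" unfolding G_def by (rule mult_carrier_mat[OF QE p0(1)])
  define H where "H = G * ?E"
  have H: "H \<in> carrier_mat M M" unfolding H_def by (rule mult_carrier_mat[OF G E])
  define R where "R = Q * ?E - G"
  have R: "R \<in> carrier_mat M M" unfolding R_def using G by (rule minus_carrier_mat)
  have GP0: "G * P0 = G" unfolding G_def as[OF QE p0(1) p0(1)] p0(3) ..
  have PQE: "P0 * (Q * ?E) = 0\<^sub>m M M"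
    unfolding as[OF p0(1) Q E, symmetric] P0Q by (rule left_mult_zero_mat[OF E])
  have P0G: "P0 * G = 0\<^sub>m M M"
    unfolding G_def as[OF p0(1) QE p0(1), symmetric] PQE by (rule left_mult_zero_mat[OF p0(1)])
  define B where "B = t \<cdot>\<^sub>m G"
  have B: "B \<in> carrier_mat M M" unfolding B_def using G by simp
  have BP0: "B * P0 = B" unfolding B_def mult_smult_assoc_mat[OF G p0(1)] GP0 ..
  have P0B: "P0 * B = 0\<^sub>m M M" unfolding B_def mult_smult_distrib[OF p0(1) G] P0G by auto
  obtain P where P: "P \<in> proj_mats M s" and PW: "P * (P0 + B) = P0 + B"
    by (rule graph_projection[OF P0 B BP0 P0B]) (rule that)
  have W: "P0 + B \<in> carrier_mat M M" using p0(1) B by simp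
  have aP0: "\<alpha> \<cdot>\<^sub>m P0 \<in> carrier_mat M M" using p0(1) by simp
  have X: "X \<in> carrier_mat M M" unfolding X_def using aP0 E by simp
  have P0X: "P0 * X \<in> carrier_mat M M" by (rule mult_carrier_mat[OF p0(1) X])
  define Y where "Y = (P0 + B) * (P0 * X)"
  have Y: "Y \<in> carrier_mat M M" unfolding Y_def by (rule mult_carrier_mat[OF W P0X])
  have PY: "P * Y = Y"
    unfolding Y_def as[OF proj_matsD(1)[OF P] W P0X, symmetric] PW ..
  have QX: "Q * X = Q * ?E"
  proof -
    have "Q * X = \<alpha> \<cdot>\<^sub>m (Q * P0) + Q * ?E"
      unfolding X_def mult_add_distrib_mat[OF Q aP0 E] mult_smult_distrib[OF Q p0(1)] ..
    then show ?thesis unfolding QP0 using QE by (simp add: smult_zero_mat)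
  qed
  have BX: "B * X = G + t \<cdot>\<^sub>m H"
  proof -
    have "B * X = \<alpha> \<cdot>\<^sub>m B + B * ?E"
      unfolding X_def mult_add_distrib_mat[OF B aP0 E] mult_smult_distrib[OF B p0(1)] BP0 ..
    also have "\<alpha> \<cdot>\<^sub>m B = G" unfolding B_def t_def using a by (intro eq_matI) auto
    also have "B * ?E = t \<cdot>\<^sub>m H" unfolding B_def H_def by (rule mult_smult_assoc_mat[OF G E])
    finally show ?thesis .
  qed
  have PPX: "P0 * (P0 * X) = P0 * X" unfolding as[OF p0(1) p0(1) X, symmetric] p0(3) ..
  have BPX: "B * (P0 * X) = B * X" unfolding as[OF B p0(1) X, symmetric] BP0 ..
  have Y_eq: "Y = P0 * X + (G + t \<cdot>\<^sub>m H)"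
    unfolding Y_def add_mult_distrib_mat[OF p0(1) B P0X] PPX BPX BX ..
  have rearrange: "A - (A' + (G + t \<cdot>\<^sub>m H)) = (- t) \<cdot>\<^sub>m H + ((A - A') - G)"
    if "A \<in> carrier_mat M M" "A' \<in> carrier_mat M M" for A A'
    using that G H by (intro eq_matI) simp_all
  have XY: "X - Y = (- t) \<cdot>\<^sub>m H + R"
    unfolding Y_eq R_def QX[symmetric] QA[OF X] by (rule rearrange[OF X P0X])
  have XX: "hs_inner X X = hs_inner (P0 * X) (P0 * X) + hs_inner (Q * ?E) (Q * ?E)"
    using proj_Pythagoras[OF P0 X] unfolding QX[symmetric] QA[OF X] .
  have QEG: "hs_inner (Q * ?E) G = hs_inner G G"
  proof -
    have "hs_inner G G = hs_inner (Q * ?E * P0) G" unfolding G_def ..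
    also have "\<dots> = hs_inner (Q * ?E) (G * P0)"
      using hs_inner_mult_right_adjoint[OF QE p0(1) G] unfolding p0(2) .
    finally show ?thesis unfolding GP0 by simp
  qed
  have RR: "hs_inner R R = hs_inner (Q * ?E) (Q * ?E) - hs_inner G G"
    unfolding R_def hs_inner_diff_left[OF QE G] hs_inner_diff_right[OF QE G QE] hs_inner_diff_right[OF QE G G]
    using QEG hs_inner_commute[OF G QE] by simp
  have main: "hs_inner (P0 * X) (P0 * X) + hs_inner G G + 2 * t * hs_inner H R - t\<^sup>2 * hs_inner H H
      \<le> hs_inner (P * X) (P * X)"
    using energy_ge_approximation[OF P X Y PY]
    unfolding XX XY hs_inner_smult_add_self[OF H R] RR by simp
  have QEN: "hs_inner (Q * ?E) (Q * ?E) \<le> N"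
    unfolding N_def QA[OF E] using proj_Pythagoras[OF P0 E] by simp
  have RN: "hs_inner R R \<le> N" using QEN RR hs_inner_self_nonneg[of G] by linarith
  have "hs_inner G G \<le> N" using QEN RR hs_inner_self_nonneg[of R] by linarith
  then have "hs_inner G G * N \<le> N * N" by (intro mult_right_mono) (simp_all add: N_def)
  then have HN: "hs_inner H H \<le> N\<^sup>2"
    using hs_inner_mult_le[OF G E] unfolding H_def N_def power2_eq_square by linarith
  \<comment> \<open>Both signs are needed, as \<open>t\<close> may be negative.\<close>
  have "0 \<le> hs_inner (1 \<cdot>\<^sub>m H + R) (1 \<cdot>\<^sub>m H + R)" "0 \<le> hs_inner ((-1) \<cdot>\<^sub>m H + R) ((-1) \<cdot>\<^sub>m H + R)"
    by simp_all
  then have "2 * \<bar>hs_inner H R\<bar> \<le> hs_inner H H + hs_inner R R"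
    unfolding hs_inner_smult_add_self[OF H R] by simp
  then have "\<bar>t\<bar> * (2 * \<bar>hs_inner H R\<bar>) \<le> \<bar>t\<bar> * (N\<^sup>2 + N)"
    using HN RN by (intro mult_left_mono) auto
  then have "\<bar>2 * t * hs_inner H R\<bar> \<le> \<bar>t\<bar> * (N\<^sup>2 + N)" by (simp add: abs_mult)
  then have 1: "- (\<bar>t\<bar> * (N\<^sup>2 + N)) \<le> 2 * t * hs_inner H R" by linarith
  have 2: "t\<^sup>2 * hs_inner H H \<le> t\<^sup>2 * N\<^sup>2" using HN by (intro mult_left_mono) auto
  have "hs_inner (P0 * X) (P0 * X) + hs_inner G G - (\<bar>t\<bar> * N + (\<bar>t\<bar> + t\<^sup>2) * N\<^sup>2)
      \<le> hs_inner (P * X) (P * X)"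
    using main 1 2 by (simp add: algebra_simps)
  then show ?thesis using that[OF P] unfolding G_def t_def by simp
qed

text \<open>
  The witnesses are the expectations of the energy of the noise and of its square. The gained
  block \<open>Q * E * P0\<close> consists of \<open>s * (M - s)\<close> independent entries.
\<close>
lemma delta_lower_bound:
  assumes \<sigma>: "\<sigma> > 0" and s: "1 \<le> s" "s \<le> M"
  obtains I1 I2 where "\<And>\<alpha>. \<alpha> \<noteq> 0 \<Longrightarrow>
    \<sigma>\<^sup>2 * real s * real (M - s) - (\<bar>1 / \<alpha>\<bar> * I1 + (\<bar>1 / \<alpha>\<bar> + (1 / \<alpha>)\<^sup>2) * I2)
      \<le> delta (C_mat M \<alpha> s) M \<sigma> s"
proof -
  let ?N = "\<lambda>\<omega>. hs_inner (noise M \<omega>) (noise M \<omega>)" and ?L = "gaussian_law M \<sigma>"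
  let ?P0 = "coord_proj M s"
  let ?Q = "1\<^sub>m M - ?P0"
  have Q: "?Q \<in> carrier_mat M M" using coord_proj_carrier by (rule minus_carrier_mat)
  have P0: "?P0 \<in> proj_mats M s" by (rule coord_proj_in_proj_mats[OF s(2)])
  note p0 = proj_matsD[OF P0]
  have ne: "proj_mats M s \<noteq> {}" using P0 by auto
  have M: "M \<ge> 1" using s by simp
  define I1 I2 where "I1 = integral\<^sup>L ?L ?N" and "I2 = integral\<^sup>L ?L (\<lambda>\<omega>. (?N \<omega>)\<^sup>2)"
  show ?thesis
  proof (rule that)
    fix \<alpha> :: real assume a: "\<alpha> \<noteq> 0"
    let ?t = "1 / \<alpha>"
    let ?X = "observation (C_mat M \<alpha> s) M"
    let ?G = "\<lambda>\<omega>. ?Q * noise M \<omega> * ?P0"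
    let ?f = "\<lambda>\<omega>. hs_inner (?P0 * ?X \<omega>) (?P0 * ?X \<omega>) + hs_inner (?G \<omega>) (?G \<omega>)
         - (\<bar>?t\<bar> * ?N \<omega> + (\<bar>?t\<bar> + ?t\<^sup>2) * (?N \<omega>)\<^sup>2)"
    have le: "?f \<omega> \<le> max_energy M s (?X \<omega>)" for \<omega>
    proof -
      obtain P where "P \<in> proj_mats M s" "?f \<omega> \<le> hs_inner (P * ?X \<omega>) (P * ?X \<omega>)"
        by (rule perturbed_energy_ge[OF s(2) a, of \<omega>]) (rule that; simp only: observation_C_mat)
      then show ?thesis
        using empirical_proj_max[OF ne observation_carrier[OF C_mat_carrier], of P \<alpha> s \<omega>]
        unfolding max_energy_def by linarith
    qed
    have "hs_inner (?P0 * C_mat M \<alpha> s) (?P0 * C_mat M \<alpha> s) = \<alpha>\<^sup>2 * real s"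
      unfolding C_mat_eq mult_smult_distrib[OF p0(1) p0(1)] p0(3) hs_inner_smult_left[OF p0(1)]
        hs_inner_smult_right[OF p0(1) p0(1)] p0(4) by (simp add: power2_eq_square)
    then have pop: "has_bochner_integral ?L (\<lambda>\<omega>. hs_inner (?P0 * ?X \<omega>) (?P0 * ?X \<omega>))
        (\<alpha>\<^sup>2 * real s + \<sigma>\<^sup>2 * real s * real M)"
      using population_energy[OF \<sigma> P0 C_mat_carrier[of M \<alpha> s]] by simp
    have G: "has_bochner_integral ?L (\<lambda>\<omega>. hs_inner (?G \<omega>) (?G \<omega>)) (\<sigma>\<^sup>2 * real (M - s) * real s)"
      using noise_energy[OF Q p0(1) \<sigma>] unfolding coord_proj_complement_energy[OF s(2)] p0(4) .
    have N1: "has_bochner_integral ?L ?N I1" and N2: "has_bochner_integral ?L (\<lambda>\<omega>. (?N \<omega>)\<^sup>2) I2"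
      unfolding I1_def I2_def
      by (rule has_bochner_integral_integrable[OF noise_energy_integrable(1)[OF \<sigma>]]
          has_bochner_integral_integrable[OF noise_energy_integrable(2)[OF \<sigma>]])+
    have F: "has_bochner_integral ?L ?f (\<alpha>\<^sup>2 * real s + \<sigma>\<^sup>2 * real s * real M
        + \<sigma>\<^sup>2 * real (M - s) * real s - (\<bar>?t\<bar> * I1 + (\<bar>?t\<bar> + ?t\<^sup>2) * I2))"
      by (rule has_bochner_integral_diff[OF has_bochner_integral_add[OF pop G]
            has_bochner_integral_add[OF has_bochner_integral_mult_right[OF N1]
              has_bochner_integral_mult_right[OF N2]]])
    have "integral\<^sup>L ?L ?f \<le> (\<integral>\<omega>. max_energy M s (?X \<omega>) \<partial>?L)"
      by (rule integral_mono[OF integrable.intros[OF F] max_energy_integrable_le(1)[OF \<sigma> M s(2)] le])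
    then show "\<sigma>\<^sup>2 * real s * real (M - s) - (\<bar>?t\<bar> * I1 + (\<bar>?t\<bar> + ?t\<^sup>2) * I2)
        \<le> delta (C_mat M \<alpha> s) M \<sigma> s"
      unfolding delta_eq[OF \<sigma> s(2)] has_bochner_integral_integral_eq[OF F] by (simp add: mult_ac)
  qed
qed

lemma Liminf_delta_ge:
  assumes \<sigma>: "\<sigma> > 0" and s: "1 \<le> s" "s \<le> M"
  shows "ereal (\<sigma>\<^sup>2 * real s * real (M - s))
    \<le> Liminf at_infinity (\<lambda>\<alpha>. ereal (delta (C_mat M \<alpha> s) M \<sigma> s))"
proof -
  obtain I1 I2 where le: "\<And>\<alpha>. \<alpha> \<noteq> 0 \<Longrightarrow>
    \<sigma>\<^sup>2 * real s * real (M - s) - (\<bar>1 / \<alpha>\<bar> * I1 + (\<bar>1 / \<alpha>\<bar> + (1 / \<alpha>)\<^sup>2) * I2)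
      \<le> delta (C_mat M \<alpha> s) M \<sigma> s"
    by (rule delta_lower_bound[OF assms]) (rule that)
  let ?f = "\<lambda>\<alpha>. \<sigma>\<^sup>2 * real s * real (M - s) - (\<bar>1 / \<alpha>\<bar> * I1 + (\<bar>1 / \<alpha>\<bar> + (1 / \<alpha>)\<^sup>2) * I2)"
  have t: "((\<lambda>\<alpha>::real. 1 / \<alpha>) \<longlongrightarrow> 0) at_infinity"
    using tendsto_inverse_0[where 'a = real] unfolding inverse_eq_divide .
  have "(?f \<longlongrightarrow> \<sigma>\<^sup>2 * real s * real (M - s) - (\<bar>0\<bar> * I1 + (\<bar>0\<bar> + 0\<^sup>2) * I2)) at_infinity"
    by (intro tendsto_intros t)
  then have "((\<lambda>\<alpha>. ereal (?f \<alpha>)) \<longlongrightarrow> ereal (\<sigma>\<^sup>2 * real s * real (M - s))) at_infinity"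
    by (intro tendsto_ereal) simp
  then have "Liminf at_infinity (\<lambda>\<alpha>. ereal (?f \<alpha>)) = ereal (\<sigma>\<^sup>2 * real s * real (M - s))"
    by (rule lim_imp_Liminf[OF trivial_limit_at_infinity])
  moreover have "eventually (\<lambda>\<alpha>::real. \<alpha> \<noteq> 0) at_infinity"
    unfolding eventually_at_infinity by (intro exI[of _ 1]) auto
  then have "Liminf at_infinity (\<lambda>\<alpha>. ereal (?f \<alpha>))
      \<le> Liminf at_infinity (\<lambda>\<alpha>. ereal (delta (C_mat M \<alpha> s) M \<sigma> s))"
    using le by (intro Liminf_mono) (auto elim!: eventually_mono)
  ultimately show ?thesis by simp
qed

theorem theorem1p3:
  shows
   "(\<exists>c\<^sub>4::real. c\<^sub>4 > 0 \<and>
       (\<forall>(M::nat) (r::nat) (\<sigma>::real) (\<alpha>::real).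
          \<sigma> > 0 \<longrightarrow> 1 \<le> r \<longrightarrow> r \<le> M - r \<longrightarrow>
          delta (C_mat M \<alpha> r) M \<sigma> r \<le> c\<^sub>4 * \<sigma>\<^sup>2 * real r * real M))
    \<and>
    (\<exists>c\<^sub>5::real. c\<^sub>5 > 0 \<and>
       (\<forall>(M::nat) (r::nat) (\<sigma>::real).
          \<sigma> > 0 \<longrightarrow> 1 \<le> r \<longrightarrow> r < M \<longrightarrow>
          Liminf at_infinity
            (\<lambda>\<alpha>::real. ereal (MAX s\<in>{r, M - r}. delta (C_mat M \<alpha> s) M \<sigma> s))
          \<ge> ereal (c\<^sub>5 * \<sigma>\<^sup>2 * real r * real (M - r)))
       \<and>
       (\<forall>(M::nat) (\<sigma>::real).
          \<sigma> > 0 \<longrightarrow> 1 < M \<longrightarrow>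
          Liminf at_infinity (\<lambda>\<alpha>::real. ereal (delta (C_mat M \<alpha> 1) M \<sigma> 1))
          \<ge> ereal (c\<^sub>5 * \<sigma>\<^sup>2 * real (M - 1))))"
proof (intro conjI)
  show "\<exists>c\<^sub>4::real. c\<^sub>4 > 0 \<and>
       (\<forall>(M::nat) (r::nat) (\<sigma>::real) (\<alpha>::real).
          \<sigma> > 0 \<longrightarrow> 1 \<le> r \<longrightarrow> r \<le> M - r \<longrightarrow>
          delta (C_mat M \<alpha> r) M \<sigma> r \<le> c\<^sub>4 * \<sigma>\<^sup>2 * real r * real M)"
    by (intro exI[of _ 1608] conjI allI impI delta_upper_bound) simp_all
next
  show "\<exists>c\<^sub>5::real. c\<^sub>5 > 0 \<and>
       (\<forall>(M::nat) (r::nat) (\<sigma>::real).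
          \<sigma> > 0 \<longrightarrow> 1 \<le> r \<longrightarrow> r < M \<longrightarrow>
          Liminf at_infinity
            (\<lambda>\<alpha>::real. ereal (MAX s\<in>{r, M - r}. delta (C_mat M \<alpha> s) M \<sigma> s))
          \<ge> ereal (c\<^sub>5 * \<sigma>\<^sup>2 * real r * real (M - r)))
       \<and>
       (\<forall>(M::nat) (\<sigma>::real).
          \<sigma> > 0 \<longrightarrow> 1 < M \<longrightarrow>
          Liminf at_infinity (\<lambda>\<alpha>::real. ereal (delta (C_mat M \<alpha> 1) M \<sigma> 1))
          \<ge> ereal (c\<^sub>5 * \<sigma>\<^sup>2 * real (M - 1)))"
  proof (intro exI[of _ 1] conjI allI impI)
    fix M r :: nat and \<sigma> :: real assume A: "\<sigma> > 0" "1 \<le> r" "r < M"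
    have "ereal (1 * \<sigma>\<^sup>2 * real r * real (M - r))
        \<le> Liminf at_infinity (\<lambda>\<alpha>. ereal (delta (C_mat M \<alpha> r) M \<sigma> r))"
      using Liminf_delta_ge[OF A(1,2)] A(3) by simp
    also have "\<dots> \<le> Liminf at_infinity
        (\<lambda>\<alpha>. ereal (MAX s\<in>{r, M - r}. delta (C_mat M \<alpha> s) M \<sigma> s))"
      by (intro Liminf_mono always_eventually allI iffD2[OF ereal_less_eq(3)] Max_ge) simp_all
    finally show "Liminf at_infinity
            (\<lambda>\<alpha>::real. ereal (MAX s\<in>{r, M - r}. delta (C_mat M \<alpha> s) M \<sigma> s))
          \<ge> ereal (1 * \<sigma>\<^sup>2 * real r * real (M - r))" .
  next
    fix M :: nat and \<sigma> :: real assume "\<sigma> > 0" "1 < M"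
    then show "Liminf at_infinity (\<lambda>\<alpha>::real. ereal (delta (C_mat M \<alpha> 1) M \<sigma> 1))
          \<ge> ereal (1 * \<sigma>\<^sup>2 * real (M - 1))"
      using Liminf_delta_ge[of \<sigma> 1 M] by simp
  qed simp
qed

end
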